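(* Let $\Omega\subset\mathbb{R}^d$ be a bounded domain, $T>0$, $\mathcal{A}=-\Delta$ with homogeneous Dirichlet boundary conditions on $\Omega$, and let $(\mu_m,\phi_m)_{m\in\mathbb{N}}$ be an eigensystem of $\mathcal{A}^{-1}$ on $L^2(\Omega)$, with $(\phi_m)$ an orthonormal basis of $L^2(\Omega)$ and $\mu_m>0$, $\mu_m\to0$ as $m\to\infty$. Consider the bounded self-adjoint operator on $L^2(0,T;L^2(\Omega))\times L^2(\Omega)$ given by $$\widetilde{\mathcal{G}^*\mathcal{G}}\begin{pmatrix} f\\ g\end{pmatrix}=\begin{pmatrix} f(t)+e^{-\mathcal{A}(T-t)}\mathcal{A}^{1/2}\int_0^T e^{-\mathcal{A}(T-s)}\mathcal{A}^{1/2}f(s)\,ds+g+e^{-\mathcal{A}(T-t)}g\\[1ex] \int_0^T f(s)\,ds+\int_0^T e^{-\mathcal{A}(T-s)}f(s)\,ds+Tg+\mathcal{A}^{-1}g\end{pmatrix}.$$ Then the following hold. (i) $\lambda_0=1$ is an eigenvalue of $\widetilde{\mathcal{G}^*\mathcal{G}}$ with infinite-dimensional eigenspace, namely the set of all $(f,0)$ with $f$ in the closed linear span of the functions $(t,x)\mapsto\psi(t)\phi_m(x)$, where $m\in\mathbb{N}$ and $\psi\in L^2(0,T)$ is $L^2(0,T)$-orthogonal to both $t\mapsto 1$ and $t\mapsto e^{-\frac{1}{\mu_m}(T-t)}$. (ii) The remaining eigenvalues of $\widetilde{\mathcal{G}^*\mathcal{G}}$ are, for $m\in\mathbb{N}$,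 the solutions $\lambda^1_{\mu_m},\lambda^2_{\mu_m},\lambda^3_{\mu_m}$ of the cubic equation $$\lambda^3-\lambda^2\left(T+\tfrac52+\alpha_m\right)+\lambda\left(\tfrac32(T+1)+\beta_m\right)=\mu_m e^{-\frac{2T}{\mu_m}},$$ with $\alpha_m=\mu_m-\tfrac12 e^{-\frac{2T}{\mu_m}}$ and $\beta_m=2\mu_m e^{-\frac{T}{\mu_m}}-\tfrac12 (T+1)e^{-\frac{2T}{\mu_m}}$. (iii) With a suitable numbering of the three solutions, as $m\to\infty$, $$\lambda^1_{\mu_m}\to 0,\qquad \lambda^2_{\mu_m}\to\max\{T+1,\tfrac32\},\qquad \lambda^3_{\mu_m}\to\min\{T+1,\tfrac32\},$$ and there is $m_0\in\mathbb{N}$ such that $\lambda^1_{\mu_m}>0$ for all $m\ge m_0$, and $$\lambda^1_{\mu_m}=O\!\left(\mu_m e^{-\frac{2T}{\mu_m}}\right)\quad\text{as } m\to\infty.$$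
   Context: $(e^{-\mathcal{A}t})_{t\ge0}$ is the heat semigroup on $L^2(\Omega)$ generated by $-\mathcal{A}$; functions of $\mathcal{A}$ are defined by the spectral calculus, i.e. $e^{-\mathcal{A}t}\phi_m=e^{-t/\mu_m}\phi_m$ and $\mathcal{A}^{1/2}\phi_m=\mu_m^{-1/2}\phi_m$. The operator $f\mapsto e^{-\mathcal{A}(T-\cdot)}\mathcal{A}^{1/2}\int_0^T e^{-\mathcal{A}(T-s)}\mathcal{A}^{1/2}f(s)\,ds$ is understood as the bounded operator on $L^2(0,T;L^2(\Omega))$ acting on the Fourier coefficients $f_m(t)=\langle f(t),\phi_m\rangle_{L^2(\Omega)}$ by $f_m\mapsto \frac{1}{\mu_m}e^{-\frac{1}{\mu_m}(T-\cdot)}\int_0^T e^{-\frac{1}{\mu_m}(T-s)}f_m(s)\,ds$. In the first component, the element $g\in L^2(\Omega)$ is identified with the time-constant function $t\mapsto g$. This operator is the transformed normal operator $(\mathcal{G}\mathcal{T}^{-1})^*\mathcal{G}\mathcal{T}^{-1}$ of the all-at-once formulation of the backwards heat problem. *)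

theory Defs
  imports "HOL-Analysis.Analysis" "HOL-Library.Landau_Symbols"
begin

section \<open>The Hilbert space of square integrable functions\<close>

definition square_integrable :: "('a::euclidean_space \<Rightarrow> 'b::{real_inner, second_countable_topology}) \<Rightarrow> bool" where
  "square_integrable f \<longleftrightarrow> f \<in> borel_measurable lborel \<and> integrable lborel (\<lambda>x. (norm (f x))\<^sup>2)"

lemma square_integrable_measurable [measurable_dest]:
  "square_integrable f \<Longrightarrow> f \<in> borel_measurable lborel"
  by (simp add: square_integrable_def)

lemma square_integrable_bound:
  fixes f :: "'a::euclidean_space \<Rightarrow> 'b::{real_inner, second_countable_topology}"
    and g :: "'a \<Rightarrow> real"
  assumes "f \<in> borel_measurable lborel" "integrable lborel g"
    and "AE x in lborel. (norm (f x))\<^sup>2 \<le> g x"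
  shows "square_integrable f"
  unfolding square_integrable_def
proof
  show "integrable lborel (\<lambda>x. (norm (f x))\<^sup>2)"
    by (rule Bochner_Integration.integrable_bound[OF assms(2)]) (use assms in auto)
qed fact

lemma norm_add_sq_le: "(norm (a + b :: 'b::real_inner))\<^sup>2 \<le> 2 * (norm a)\<^sup>2 + 2 * (norm b)\<^sup>2"
proof -
  have "0 \<le> (norm (a - b))\<^sup>2" by simp
  then show ?thesis
    by (simp add: power2_norm_eq_inner algebra_simps inner_commute)
qed

lemma square_integrable_add:
  assumes "square_integrable f" "square_integrable g"
  shows "square_integrable (\<lambda>x. f x + g x)"
proof (rule square_integrable_bound[where g="\<lambda>x. 2 * (norm (f x))\<^sup>2 + 2 * (norm (g x))\<^sup>2"])
  show "integrable lborel (\<lambda>x. 2 * (norm (f x))\<^sup>2 + 2 * (norm (g x))\<^sup>2)"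
    using assms by (auto simp: square_integrable_def)
qed (use assms in \<open>auto simp: square_integrable_def norm_add_sq_le\<close>)

lemma square_integrable_scaleR:
  "square_integrable f \<Longrightarrow> square_integrable (\<lambda>x. c *\<^sub>R f x)"
  by (auto simp: square_integrable_def power_mult_distrib)

lemma square_integrable_diff:
  "square_integrable f \<Longrightarrow> square_integrable g \<Longrightarrow> square_integrable (\<lambda>x. f x - g x)"
  using square_integrable_add[of f "\<lambda>x. (-1) *\<^sub>R g x"] square_integrable_scaleR[of g "-1"] by simp

lemma square_integrable_zero: "square_integrable (\<lambda>x. 0)"
  by (simp add: square_integrable_def)

lemma integrable_inner_square_integrable:
  assumes "square_integrable f" "square_integrable g"
  shows "integrable lborel (\<lambda>x. inner (f x) (g x))"
proof (rule Bochner_Integration.integrable_bound)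
  show "integrable lborel (\<lambda>x. (norm (f x))\<^sup>2 + (norm (g x))\<^sup>2)"
    using assms by (auto simp: square_integrable_def)
  show "(\<lambda>x. inner (f x) (g x)) \<in> borel_measurable lborel"
    using assms by (auto simp: square_integrable_def)
  have "\<bar>inner a b\<bar> \<le> (norm a)\<^sup>2 + (norm b)\<^sup>2" for a b :: 'b
  proof -
    have "\<bar>inner a b\<bar> \<le> norm a * norm b" by (rule Cauchy_Schwarz_ineq2)
    also have "\<dots> \<le> (norm a)\<^sup>2 + (norm b)\<^sup>2"
      using sum_squares_bound[of "norm a" "norm b"] mult_nonneg_nonneg[OF norm_ge_zero norm_ge_zero, of a b]
      by linarith
    finally show ?thesis .
  qed
  then show "AE x in lborel. norm (inner (f x) (g x)) \<le> norm ((norm (f x))\<^sup>2 + (norm (g x))\<^sup>2)"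
    by simp
qed

text \<open>
  Square integrable functions on the whole Euclidean space up to equality almost everywhere.
  The space \<open>L\<^sup>2(S)\<close> is the closed subspace of classes vanishing outside \<open>S\<close>, see \<open>L2_on\<close> below.
  The codomain may itself be such a space, which gives Bochner spaces like \<open>L\<^sup>2(0,T;L\<^sup>2(\<Omega>))\<close>.
\<close>

quotient_type (overloaded) ('a, 'b) L2 = "'a::euclidean_space \<Rightarrow> 'b::{real_inner, second_countable_topology}" / partial:
  "\<lambda>f g. square_integrable f \<and> square_integrable g \<and> (AE x in lborel. f x = g x)"
  morphisms rep_L2 abs_L2
proof (rule part_equivpI)
  show "\<exists>f::'a \<Rightarrow> 'b. square_integrable f \<and> square_integrable f \<and> (AE x in lborel. f x = f x)"
    using square_integrable_zero by auto
  show "symp (\<lambda>f (g::'a \<Rightarrow> 'b). square_integrable f \<and> square_integrable g \<and> (AE x in lborel. f x = g x))"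
    by (auto intro!: sympI)
  show "transp (\<lambda>f (g::'a \<Rightarrow> 'b). square_integrable f \<and> square_integrable g \<and> (AE x in lborel. f x = g x))"
  proof (rule transpI, elim conjE, intro conjI)
    fix f g h :: "'a \<Rightarrow> 'b"
    assume "AE x in lborel. f x = g x" "AE x in lborel. g x = h x"
    then show "AE x in lborel. f x = h x" by eventually_elim simp
  qed
qed

instantiation L2 :: (euclidean_space, "{real_inner, second_countable_topology}") real_vector
begin

lift_definition zero_L2 :: "('a, 'b) L2" is "\<lambda>x. 0"
  by (simp add: square_integrable_zero)

lift_definition plus_L2 :: "('a, 'b) L2 \<Rightarrow> ('a, 'b) L2 \<Rightarrow> ('a, 'b) L2" is "\<lambda>f g x. f x + g x"
  by (auto simp: square_integrable_add)

lift_definition minus_L2 :: "('a, 'b) L2 \<Rightarrow> ('a, 'b) L2 \<Rightarrow> ('a, 'b) L2" is "\<lambda>f g x. f x - g x"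
  by (auto simp: square_integrable_diff)

lift_definition uminus_L2 :: "('a, 'b) L2 \<Rightarrow> ('a, 'b) L2" is "\<lambda>f x. - f x"
  using square_integrable_scaleR[where c="-1"] by (auto)

lift_definition scaleR_L2 :: "real \<Rightarrow> ('a, 'b) L2 \<Rightarrow> ('a, 'b) L2" is "\<lambda>c f x. c *\<^sub>R f x"
  by (auto simp: square_integrable_scaleR)

instance
proof
  fix u v w :: "('a, 'b) L2" and a b :: real
  show "u + v + w = u + (v + w)"
    by transfer (auto intro!: square_integrable_add simp: add.assoc)
  show "u + v = v + u"
    by transfer (auto intro!: square_integrable_add simp: add.commute)
  show "0 + u = u" by transfer auto
  show "- u + u = 0"
    by transfer (auto simp: square_integrable_zero)
  show "u - v = u + - v"
    by transfer (auto intro!: square_integrable_diff)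
  show "a *\<^sub>R (u + v) = a *\<^sub>R u + a *\<^sub>R v"
    by transfer (auto intro!: square_integrable_add square_integrable_scaleR simp: scaleR_add_right)
  show "(a + b) *\<^sub>R u = a *\<^sub>R u + b *\<^sub>R u"
    by transfer (auto intro!: square_integrable_add square_integrable_scaleR simp: scaleR_add_left)
  show "a *\<^sub>R b *\<^sub>R u = (a * b) *\<^sub>R u"
    by transfer (auto intro!: square_integrable_scaleR)
  show "1 *\<^sub>R u = u" by transfer auto
qed

end

instantiation L2 :: (euclidean_space, "{real_inner, second_countable_topology}") real_inner
begin

lift_definition inner_L2 :: "('a, 'b) L2 \<Rightarrow> ('a, 'b) L2 \<Rightarrow> real"
  is "\<lambda>f g. LINT x|lborel. inner (f x) (g x)"
proof (elim conjE)
  fix f f' g g' :: "'a \<Rightarrow> 'b"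
  assume [measurable]: "square_integrable f" "square_integrable f'" "square_integrable g" "square_integrable g'"
    and eq: "AE x in lborel. f x = f' x" "AE x in lborel. g x = g' x"
  from eq have "AE x in lborel. inner (f x) (g x) = inner (f' x) (g' x)"
    by eventually_elim simp
  then show "(LINT x|lborel. inner (f x) (g x)) = (LINT x|lborel. inner (f' x) (g' x))"
    by (intro integral_cong_AE; measurable)
qed

definition norm_L2 :: "('a, 'b) L2 \<Rightarrow> real" where "norm_L2 u = sqrt (inner u u)"
definition dist_L2 :: "('a, 'b) L2 \<Rightarrow> ('a, 'b) L2 \<Rightarrow> real" where "dist_L2 u v = norm (u - v)"
definition sgn_L2 :: "('a, 'b) L2 \<Rightarrow> ('a, 'b) L2" where "sgn_L2 u = inverse (norm u) *\<^sub>R u"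
definition uniformity_L2 :: "(('a, 'b) L2 \<times> ('a, 'b) L2) filter"
  where "uniformity_L2 = (INF e\<in>{0<..}. principal {(u, v). dist u v < e})"
definition open_L2 :: "('a, 'b) L2 set \<Rightarrow> bool"
  where "open_L2 U \<longleftrightarrow> (\<forall>u\<in>U. eventually (\<lambda>(u', v). u' = u \<longrightarrow> v \<in> U) uniformity)"

instance
proof
  fix u v w :: "('a, 'b) L2" and a b :: real
  show "dist u v = norm (u - v)" by (rule dist_L2_def)
  show "sgn u = u /\<^sub>R norm u" by (rule sgn_L2_def)
  show "uniformity = (INF e\<in>{0<..}. principal {(u::('a, 'b) L2, v). dist u v < e})"
    by (rule uniformity_L2_def)
  show "open U \<longleftrightarrow> (\<forall>u\<in>U. eventually (\<lambda>(u', v). u' = u \<longrightarrow> v \<in> U) uniformity)" for U :: "('a, 'b) L2 set"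
    by (rule open_L2_def)
  show "inner u v = inner v u"
    by transfer (simp add: inner_commute)
  show "inner (u + v) w = inner u w + inner v w"
    by transfer (auto simp: inner_add_left integrable_inner_square_integrable)
  show "inner (a *\<^sub>R u) v = a * inner u v"
    by transfer simp
  show "0 \<le> inner u u"
    by transfer simp
  show "inner u u = 0 \<longleftrightarrow> u = 0"
  proof transfer
    fix f :: "'a \<Rightarrow> 'b"
    assume "square_integrable f \<and> square_integrable f \<and> (AE x in lborel. f x = f x)"
    then have f: "square_integrable f" by simp
    have "(LINT x|lborel. inner (f x) (f x)) = 0 \<longleftrightarrow> (AE x in lborel. inner (f x) (f x) = 0)"
      by (rule integral_nonneg_eq_0_iff_AE[OF integrable_inner_square_integrable[OF f f]]) simp
    with f show "((LINT x|lborel. inner (f x) (f x)) = 0) =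
      (square_integrable f \<and> square_integrable (\<lambda>x::'a. 0::'b) \<and> (AE x in lborel. f x = 0))"
      by (simp add: square_integrable_zero)
  qed
  show "norm u = sqrt (inner u u)" by (rule norm_L2_def)
qed

end

lemma square_integrable_rep_L2: "square_integrable (rep_L2 u)"
  using Quotient3_rep_reflp[OF Quotient3_L2, of u] by simp

lemma abs_rep_L2: "abs_L2 (rep_L2 u) = u"
  by (rule Quotient3_abs_rep[OF Quotient3_L2])

lemma abs_L2_cong:
  assumes "square_integrable f" "square_integrable g" "AE x in lborel. f x = g x"
  shows "abs_L2 f = abs_L2 g"
  by (rule Quotient3_rel_abs[OF Quotient3_L2]) (use assms in simp)

lemma rep_abs_L2:
  assumes "square_integrable f"
  shows "AE x in lborel. rep_L2 (abs_L2 f) x = f x"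
  using rep_abs_rsp_left[OF Quotient3_L2, of f f] assms by simp

lemma abs_L2_add:
  "square_integrable f \<Longrightarrow> square_integrable g \<Longrightarrow> abs_L2 f + abs_L2 g = abs_L2 (\<lambda>x. f x + g x)"
  by (simp add: plus_L2.abs_eq)

lemma abs_L2_diff:
  "square_integrable f \<Longrightarrow> square_integrable g \<Longrightarrow> abs_L2 f - abs_L2 g = abs_L2 (\<lambda>x. f x - g x)"
  by (simp add: minus_L2.abs_eq)

lemma norm_abs_L2:
  "square_integrable f \<Longrightarrow> (norm (abs_L2 f))\<^sup>2 = (LINT x|lborel. (norm (f x))\<^sup>2)"
  by (simp add: power2_norm_eq_inner inner_L2.abs_eq)

lemma dist_L2_rep: "(dist u v)\<^sup>2 = (LINT x|lborel. (norm (rep_L2 u x - rep_L2 v x))\<^sup>2)"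
proof -
  have "u - v = abs_L2 (\<lambda>x. rep_L2 u x - rep_L2 v x)"
    using abs_L2_diff[OF square_integrable_rep_L2 square_integrable_rep_L2, of u v] by (simp add: abs_rep_L2)
  then show ?thesis
    by (simp add: dist_norm norm_abs_L2 square_integrable_diff square_integrable_rep_L2)
qed

lemma abs_L2_tendsto_dominated:
  fixes F :: "nat \<Rightarrow> 'a::euclidean_space \<Rightarrow> 'b::{real_inner, second_countable_topology}"
  assumes f: "square_integrable f" and F: "\<And>i. F i \<in> borel_measurable lborel"
    and lim: "\<And>x. (\<lambda>i. F i x) \<longlonglongrightarrow> f x" and bound: "\<And>i x. norm (F i x) \<le> 2 * norm (f x)"
  shows "square_integrable (F i)" and "(\<lambda>i. abs_L2 (F i)) \<longlonglongrightarrow> abs_L2 f"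
proof -
  have bound2: "(norm (F i x))\<^sup>2 \<le> 4 * (norm (f x))\<^sup>2" for i x
    using power_mono[OF bound[of i x], of 2] by (simp add: power_mult_distrib)
  have int_f: "integrable lborel (\<lambda>x. c * (norm (f x))\<^sup>2)" for c
    using f by (simp add: square_integrable_def)
  show si: "square_integrable (F i)" for i
    by (rule square_integrable_bound[OF F int_f[of 4]]) (simp add: bound2)
  note [measurable] = F f
  have "(\<lambda>i. LINT x|lborel. (norm (F i x - f x))\<^sup>2) \<longlonglongrightarrow> (LINT x|(lborel::'a measure). 0::real)"
  proof (rule integral_dominated_convergence[where w="\<lambda>x. 10 * (norm (f x))\<^sup>2"])
    show "AE x in lborel. (\<lambda>i. (norm (F i x - f x))\<^sup>2) \<longlonglongrightarrow> 0"
    proof (rule AE_I2)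
      fix x
      have "(\<lambda>i. (norm (F i x - f x))\<^sup>2) \<longlonglongrightarrow> (norm (f x - f x))\<^sup>2"
        by (intro tendsto_intros lim)
      then show "(\<lambda>i. (norm (F i x - f x))\<^sup>2) \<longlonglongrightarrow> 0" by simp
    qed
    show "AE x in lborel. norm ((norm (F i x - f x))\<^sup>2) \<le> 10 * (norm (f x))\<^sup>2" for i
    proof (rule AE_I2)
      fix x
      show "norm ((norm (F i x - f x))\<^sup>2) \<le> 10 * (norm (f x))\<^sup>2"
        using norm_add_sq_le[of "F i x" "- f x"] bound2[of i x] by simp
    qed
    show "(\<lambda>x. (norm (F i x - f x))\<^sup>2) \<in> borel_measurable lborel" for i
      by measurable
  qed (use int_f[of 10] in auto)
  then have "(\<lambda>i. (norm (abs_L2 (F i) - abs_L2 f))\<^sup>2) \<longlonglongrightarrow> 0"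
    by (simp add: abs_L2_diff norm_abs_L2 square_integrable_diff si f)
  from tendsto_real_sqrt[OF this] have "(\<lambda>i. norm (abs_L2 (F i) - abs_L2 f)) \<longlonglongrightarrow> 0"
    by simp
  then show "(\<lambda>i. abs_L2 (F i)) \<longlonglongrightarrow> abs_L2 f"
    by (simp only: tendsto_norm_zero_iff LIM_zero_iff)
qed

lemma AE_L2_fast_Cauchy_convergent:
  fixes Y :: "nat \<Rightarrow> ('a::euclidean_space, 'b::{real_inner, banach, second_countable_topology}) L2"
  assumes "\<And>n. dist (Y (Suc n)) (Y n) \<le> (1/2)^n"
  shows "AE x in lborel. convergent (\<lambda>n. rep_L2 (Y n) x)"
proof -
  define d where "d n x = (norm (rep_L2 (Y (Suc n)) x - rep_L2 (Y n) x))\<^sup>2" for n x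
  have [measurable]: "rep_L2 (Y n) \<in> borel_measurable lborel" for n
    using square_integrable_rep_L2 by (rule square_integrable_measurable)
  have dm [measurable]: "d n \<in> borel_measurable lborel" for n
    unfolding d_def by measurable
  have d_int: "integrable lborel (d n)" for n
    using square_integrable_diff[OF square_integrable_rep_L2[of "Y (Suc n)"] square_integrable_rep_L2[of "Y n"]]
    by (simp add: d_def[abs_def] square_integrable_def)
  have d_le: "(\<integral>\<^sup>+x. ennreal (2^n * d n x) \<partial>lborel) \<le> ennreal ((1/2)^n)" for n
  proof -
    have "(\<integral>\<^sup>+x. ennreal (2^n * d n x) \<partial>lborel) = ennreal (LINT x|lborel. 2^n * d n x)"
      by (intro nn_integral_eq_integral integrable_mult_right d_int) (simp add: d_def)
    also have "(LINT x|lborel. 2^n * d n x) = 2^n * (dist (Y (Suc n)) (Y n))\<^sup>2"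
      by (simp add: dist_L2_rep d_def)
    also have "ennreal \<dots> \<le> ennreal (2^n * ((1/2)^n)\<^sup>2)"
      by (intro ennreal_leI mult_left_mono power_mono assms) auto
    also have "2^n * ((1/2)^n)\<^sup>2 = (1/2::real)^n"
      by (simp add: power2_eq_square power_divide)
    finally show ?thesis .
  qed
  have "(\<integral>\<^sup>+x. (\<Sum>n. ennreal (2^n * d n x)) \<partial>lborel) = (\<Sum>n. \<integral>\<^sup>+x. ennreal (2^n * d n x) \<partial>lborel)"
    by (intro nn_integral_suminf) measurable
  also have "\<dots> \<le> (\<Sum>n. ennreal ((1/2)^n))"
    by (intro suminf_le d_le) auto
  also have "\<dots> = ennreal (\<Sum>n. (1/2)^n)"
    by (intro suminf_ennreal2) (auto intro: summable_geometric)
  finally have "(\<integral>\<^sup>+x. (\<Sum>n. ennreal (2^n * d n x)) \<partial>lborel) \<noteq> \<infinity>"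
    by (auto simp: top_unique)
  then have "AE x in lborel. (\<Sum>n. ennreal (2^n * d n x)) \<noteq> \<infinity>"
    by (intro nn_integral_noteq_infinite) measurable
  then show ?thesis
  proof eventually_elim
    case (elim x)
    have "summable (\<lambda>n. 2^n * d n x)"
      by (rule summable_suminf_not_top) (use elim in \<open>auto simp: d_def\<close>)
    then have "summable (\<lambda>n. 2^n * d n x + (1/2)^n)"
      by (intro summable_add summable_geometric) auto
    then have "summable (\<lambda>n. rep_L2 (Y (Suc n)) x - rep_L2 (Y n) x)"
    proof (rule summable_comparison_test'[where N=0])
      fix n :: nat
      define t where "t = norm (rep_L2 (Y (Suc n)) x - rep_L2 (Y n) x)"
      have "0 \<le> (2^n * t - 1)\<^sup>2 / 2^n" by simp
      also have "\<dots> = 2^n * t\<^sup>2 - 2 * t + (1/2)^n"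
        by (simp add: power2_eq_square field_simps power_divide)
      finally have "2 * t \<le> 2^n * t\<^sup>2 + (1/2)^n" by simp
      moreover have "0 \<le> t" by (simp add: t_def)
      ultimately show "norm (rep_L2 (Y (Suc n)) x - rep_L2 (Y n) x) \<le> 2^n * d n x + (1/2)^n"
        unfolding d_def t_def[symmetric] by linarith
    qed
    then have "convergent (\<lambda>n. \<Sum>i<n. rep_L2 (Y (Suc i)) x - rep_L2 (Y i) x)"
      by (simp add: summable_iff_convergent)
    then have "convergent (\<lambda>n. rep_L2 (Y n) x - rep_L2 (Y 0) x)"
      by (simp only: sum_lessThan_telescope[of "\<lambda>n. rep_L2 (Y n) x"])
    then show ?case
      using convergent_diff_const_right_iff[of "\<lambda>n. rep_L2 (Y n) x" "rep_L2 (Y 0) x"] by simp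
  qed
qed

lemma L2_fast_Cauchy_convergent:
  fixes Y :: "nat \<Rightarrow> ('a::euclidean_space, 'b::{real_inner, banach, second_countable_topology}) L2"
  assumes Y: "\<And>n k. n \<le> k \<Longrightarrow> dist (Y k) (Y n) \<le> (1/2)^n"
  shows "convergent Y"
proof -
  define h where "h x = lim (\<lambda>n. rep_L2 (Y n) x)" for x
  have Ym [measurable]: "rep_L2 (Y n) \<in> borel_measurable lborel" for n
    using square_integrable_rep_L2 by (rule square_integrable_measurable)
  have hm [measurable]: "h \<in> borel_measurable lborel"
    unfolding h_def by measurable
  have "AE x in lborel. convergent (\<lambda>n. rep_L2 (Y n) x)"
    by (rule AE_L2_fast_Cauchy_convergent) (simp add: Y)
  then have lim: "AE x in lborel. (\<lambda>n. rep_L2 (Y n) x) \<longlonglongrightarrow> h x"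
    by eventually_elim (simp add: h_def convergent_LIMSEQ_iff)
  have le: "(\<integral>\<^sup>+x. ennreal ((norm (h x - rep_L2 (Y n) x))\<^sup>2) \<partial>lborel) \<le> ennreal (((1/2)^n)\<^sup>2)" for n
  proof -
    have "(\<integral>\<^sup>+x. ennreal ((norm (h x - rep_L2 (Y n) x))\<^sup>2) \<partial>lborel)
      = (\<integral>\<^sup>+x. liminf (\<lambda>k. ennreal ((norm (rep_L2 (Y k) x - rep_L2 (Y n) x))\<^sup>2)) \<partial>lborel)"
    proof (rule nn_integral_cong_AE)
      show "AE x in lborel. ennreal ((norm (h x - rep_L2 (Y n) x))\<^sup>2)
        = liminf (\<lambda>k. ennreal ((norm (rep_L2 (Y k) x - rep_L2 (Y n) x))\<^sup>2))"
        using lim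
      proof eventually_elim
        case (elim x)
        have "(\<lambda>k. ennreal ((norm (rep_L2 (Y k) x - rep_L2 (Y n) x))\<^sup>2))
          \<longlonglongrightarrow> ennreal ((norm (h x - rep_L2 (Y n) x))\<^sup>2)"
          by (intro tendsto_intros tendsto_ennrealI elim)
        then show ?case
          by (intro lim_imp_Liminf[symmetric]) auto
      qed
    qed
    also have "\<dots> \<le> liminf (\<lambda>k. \<integral>\<^sup>+x. ennreal ((norm (rep_L2 (Y k) x - rep_L2 (Y n) x))\<^sup>2) \<partial>lborel)"
      by (intro nn_integral_liminf) measurable
    also have "\<dots> \<le> limsup (\<lambda>k. \<integral>\<^sup>+x. ennreal ((norm (rep_L2 (Y k) x - rep_L2 (Y n) x))\<^sup>2) \<partial>lborel)"
      by (intro Liminf_le_Limsup) auto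
    also have "\<dots> \<le> ennreal (((1/2)^n)\<^sup>2)"
    proof (rule Limsup_bounded)
      show "\<forall>\<^sub>F k in sequentially. (\<integral>\<^sup>+x. ennreal ((norm (rep_L2 (Y k) x - rep_L2 (Y n) x))\<^sup>2) \<partial>lborel)
        \<le> ennreal (((1/2)^n)\<^sup>2)"
        using eventually_ge_at_top[of n]
      proof eventually_elim
        case (elim k)
        have "(\<integral>\<^sup>+x. ennreal ((norm (rep_L2 (Y k) x - rep_L2 (Y n) x))\<^sup>2) \<partial>lborel)
          = ennreal ((dist (Y k) (Y n))\<^sup>2)"
          using square_integrable_diff[OF square_integrable_rep_L2[of "Y k"] square_integrable_rep_L2[of "Y n"]]
          unfolding dist_L2_rep by (intro nn_integral_eq_integral) (auto simp: square_integrable_def)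
        also have "\<dots> \<le> ennreal (((1/2)^n)\<^sup>2)"
          by (intro ennreal_leI power_mono Y elim) auto
        finally show ?case .
      qed
    qed
    finally show ?thesis .
  qed
  have diff: "square_integrable (\<lambda>x. h x - rep_L2 (Y n) x)" for n
    unfolding square_integrable_def
    using le[of n] by (auto simp: integrable_iff_bounded intro: le_less_trans)
  have h: "square_integrable h"
    using square_integrable_add[OF diff[of 0] square_integrable_rep_L2[of "Y 0"]] by simp
  have dist_le: "dist (Y n) (abs_L2 h) \<le> (1/2)^n" for n
  proof -
    have "abs_L2 h - Y n = abs_L2 (\<lambda>x. h x - rep_L2 (Y n) x)"
      using abs_L2_diff[OF h square_integrable_rep_L2[of "Y n"]] by (simp add: abs_rep_L2)
    then have "(dist (abs_L2 h) (Y n))\<^sup>2 = (LINT x|lborel. (norm (h x - rep_L2 (Y n) x))\<^sup>2)"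
      by (simp add: dist_norm norm_abs_L2 diff)
    also have "ennreal \<dots> = (\<integral>\<^sup>+x. ennreal ((norm (h x - rep_L2 (Y n) x))\<^sup>2) \<partial>lborel)"
      using diff[of n] by (intro nn_integral_eq_integral[symmetric]) (auto simp: square_integrable_def)
    finally have "ennreal ((dist (abs_L2 h) (Y n))\<^sup>2) \<le> ennreal (((1/2)^n)\<^sup>2)"
      using le[of n] by simp
    then have "(dist (abs_L2 h) (Y n))\<^sup>2 \<le> ((1/2)^n)\<^sup>2"
      by (subst (asm) ennreal_le_iff) auto
    then show ?thesis
      by (subst dist_commute) (rule power2_le_imp_le, auto)
  qed
  have "(\<lambda>n. dist (Y n) (abs_L2 h)) \<longlonglongrightarrow> 0"
  proof (rule tendsto_sandwich[where f="\<lambda>_. 0" and h="\<lambda>n. (1/2::real)^n"])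
    show "(\<lambda>n. (1/2::real)^n) \<longlonglongrightarrow> 0" by (rule LIMSEQ_power_zero) simp
  qed (use dist_le in auto)
  then show ?thesis
    unfolding convergent_def using tendsto_dist_iff[of Y "abs_L2 h" sequentially] by blast
qed

instance L2 :: (euclidean_space, "{real_inner, banach, second_countable_topology}") banach
proof
  fix X :: "nat \<Rightarrow> ('a, 'b) L2"
  assume X: "Cauchy X"
  have "\<forall>n. \<exists>M. \<forall>p\<ge>M. \<forall>q\<ge>M. dist (X p) (X q) < (1/2)^n"
    using X unfolding Cauchy_def by simp
  then obtain N where N: "\<And>n p q. N n \<le> p \<Longrightarrow> N n \<le> q \<Longrightarrow> dist (X p) (X q) < (1/2)^n"
    by metis
  define r where "r n = (\<Sum>k\<le>n. N k) + n" for n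
  have "strict_mono r"
    by (rule strict_monoI_Suc) (simp add: r_def)
  have N_le: "N n \<le> r k" if "n \<le> k" for n k
    using member_le_sum[of n "{..k}" N] that by (simp add: r_def)
  have "convergent (\<lambda>n. X (r n))"
    by (rule L2_fast_Cauchy_convergent) (use N N_le in \<open>auto intro!: less_imp_le\<close>)
  then obtain L where "(X \<circ> r) \<longlonglongrightarrow> L"
    by (auto simp: convergent_def comp_def)
  from Cauchy_converges_subseq[OF X \<open>strict_mono r\<close> this] show "convergent X"
    by (auto simp: convergent_def)
qed

lemma closure_add:
  fixes D :: "'a::real_normed_vector set"
  assumes D: "\<And>u v. u \<in> D \<Longrightarrow> v \<in> D \<Longrightarrow> u + v \<in> D" and "u \<in> closure D" "v \<in> closure D"
  shows "u + v \<in> closure D"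
proof -
  obtain x y where "\<And>n. x n \<in> D" "x \<longlonglongrightarrow> u" "\<And>n. y n \<in> D" "y \<longlonglongrightarrow> v"
    using assms(2,3) unfolding closure_sequential by blast
  then show ?thesis
    unfolding closure_sequential
    by (intro exI[of _ "\<lambda>n. x n + y n"]) (auto intro: D tendsto_add)
qed

lemma closure_limit:
  fixes D :: "'a::metric_space set"
  shows "(\<And>n. x n \<in> closure D) \<Longrightarrow> x \<longlonglongrightarrow> u \<Longrightarrow> u \<in> closure D"
  using closed_sequentially[of "closure D" x u] by simp

lemma square_integrable_indicator:
  fixes A :: "'a::euclidean_space set" and y :: "'b::{real_inner, second_countable_topology}"
  assumes "A \<in> sets borel"
  shows "square_integrable (\<lambda>x. indicator (A \<inter> ball 0 r) x *\<^sub>R y)"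
proof (rule square_integrable_bound[where g="\<lambda>x. indicator (ball 0 r) x * (norm y)\<^sup>2"])
  show "integrable lborel (\<lambda>x::'a. indicator (ball 0 r) x * (norm y)\<^sup>2 :: real)"
    using emeasure_bounded_finite[OF bounded_ball, of "0::'a" r]
    by (intro integrable_mult_left) (simp add: integrable_indicator_iff)
qed (use assms in \<open>auto simp: indicator_def\<close>)

lemma indicator_scaleR_tendsto:
  fixes A :: "nat \<Rightarrow> 'a set" and y :: "'b::real_normed_vector"
  assumes "incseq A"
  shows "(\<lambda>n. indicator (A n \<inter> B) x *\<^sub>R y) \<longlonglongrightarrow> indicator ((\<Union>n. A n) \<inter> B) x *\<^sub>R y"
proof (intro tendsto_scaleR tendsto_const tendsto_eventually)
  show "\<forall>\<^sub>F n in sequentially. indicator (A n \<inter> B) x = (indicator ((\<Union>n. A n) \<inter> B) x :: real)"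
  proof (cases "\<exists>k. x \<in> A k")
    case True
    then obtain k where "x \<in> A k" by blast
    then have "x \<in> A n" if "k \<le> n" for n
      using incseqD[OF assms that] by blast
    then show ?thesis
      by (auto simp: eventually_sequentially indicator_def)
  qed (auto simp: indicator_def)
qed

lemma ex_countable_dense_L2:
  "\<exists>D :: ('a::euclidean_space, 'b::{real_inner, second_countable_topology}) L2 set. countable D \<and> closure D = UNIV"
proof -
  define I where "I A r y = (abs_L2 (\<lambda>x. indicator (A \<inter> ball 0 r) x *\<^sub>R y) :: ('a, 'b) L2)" for A r y
  obtain B :: "'a set set" where B: "countable B" "topological_basis B"
    using ex_countable_basis by blast
  define C where "C = (\<lambda>F. \<Inter>F) ` {F. finite F \<and> F \<subseteq> B}"
  have "countable C"
    unfolding C_def by (intro countable_image) (use countable_Collect_finite_subset[OF B(1)] in simp)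
  have C_Int: "Int_stable C"
  proof (rule Int_stableI)
    fix a b assume "a \<in> C" "b \<in> C"
    then obtain F G where "finite F" "F \<subseteq> B" "a = \<Inter>F" "finite G" "G \<subseteq> B" "b = \<Inter>G"
      unfolding C_def by blast
    then show "a \<inter> b \<in> C"
      unfolding C_def by (intro image_eqI[of _ _ "F \<union> G"]) auto
  qed
  have C_Pow: "C \<subseteq> Pow UNIV" by simp
  have "UNIV \<in> C"
    unfolding C_def by (intro image_eqI[of _ _ "{}"]) auto
  have C_borel: "K \<in> sets borel" if "K \<in> C" for K
    using that topological_basis_open[OF B(2)] unfolding C_def
    by (auto intro!: borel_open open_Inter)
  have "B \<subseteq> C"
  proof
    fix b assume "b \<in> B"
    then show "b \<in> C" unfolding C_def by (intro image_eqI[of _ _ "{b}"]) auto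
  qed
  then have sigma_B: "sigma_sets UNIV B \<subseteq> sigma_sets UNIV C"
    by (rule sigma_sets_mono')
  have borel_C: "A \<in> sigma_sets UNIV C" if "A \<in> sets borel" for A
  proof -
    have "A \<in> sets (sigma UNIV B)"
      using that borel_eq_countable_basis[OF B] by simp
    then show ?thesis
      using sigma_B by (auto simp: sets_measure_of)
  qed
  obtain Y :: "'b set" where Y: "countable Y" "\<And>X. open X \<Longrightarrow> X \<noteq> {} \<Longrightarrow> \<exists>d\<in>Y. d \<in> X"
    by (erule countable_dense_setE)
  define G where "G = (\<lambda>(K, n, y). I K (real n) y) ` (C \<times> (UNIV::nat set) \<times> Y)"
  define D where "D = sum_list ` lists G"
  have "countable D"
    unfolding D_def G_def
    by (intro countable_image countable_lists countable_SIGMA \<open>countable C\<close> Y(1) countableI_type)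
  have D_add: "u + v \<in> D" if uv: "u \<in> D" "v \<in> D" for u v
  proof -
    obtain us vs where "us \<in> lists G" "vs \<in> lists G" "u = sum_list us" "v = sum_list vs"
      using uv unfolding D_def by blast
    then show ?thesis
      unfolding D_def by (intro image_eqI[of _ _ "us @ vs"]) auto
  qed
  have W_add: "u + v \<in> closure D" if "u \<in> closure D" "v \<in> closure D" for u v
    by (rule closure_add[OF _ that]) (rule D_add)
  have "sum_list [] \<in> D"
    unfolding D_def by (rule imageI) simp
  then have W_zero: "0 \<in> closure D"
    using closure_subset[of D] by auto

  have I_add: "I A r y + I A' r y' = abs_L2 (\<lambda>x. indicator (A \<inter> ball 0 r) x *\<^sub>R y + indicator (A' \<inter> ball 0 r) x *\<^sub>R y')"
    if "A \<in> sets borel" "A' \<in> sets borel" for A A' r y y'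
    unfolding I_def by (intro abs_L2_add square_integrable_indicator that)
  have W_gen: "I K (real n) y \<in> closure D" if K: "K \<in> C" for K n y
  proof -
    have "\<exists>z\<in>Y. dist z y < 1 / Suc i" for i
      using Y(2)[of "ball y (1 / Suc i)"] by (auto simp: dist_commute)
    then obtain z where z: "\<And>i. z i \<in> Y" "\<And>i. dist (z i) y < 1 / Suc i"
      by metis
    have z_lim: "z \<longlonglongrightarrow> y"
    proof (rule metric_LIMSEQ_I)
      fix e :: real assume "0 < e"
      then obtain m where "1 / Suc m < e" using nat_approx_posE by auto
      moreover have "1 / real (Suc i) \<le> 1 / real (Suc m)" if "m \<le> i" for i
        using that by (simp add: field_simps)
      ultimately show "\<exists>m. \<forall>i\<ge>m. dist (z i) y < e"
        using z(2) by (intro exI[of _ m]) (meson less_le_trans less_trans)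
    qed
    define c where "c = (LINT x|lborel. (indicator (K \<inter> ball 0 (real n)) (x::'a) :: real))"
    have "(\<lambda>i. (norm (I K (real n) (z i) - I K (real n) y))\<^sup>2) = (\<lambda>i. c * (norm (z i - y))\<^sup>2)"
    proof
      fix i
      have "I K (real n) (z i) - I K (real n) y = I K (real n) (z i - y)"
        using K unfolding I_def
        by (simp add: abs_L2_diff square_integrable_indicator C_borel scaleR_diff_right)
      then have "(norm (I K (real n) (z i) - I K (real n) y))\<^sup>2
        = (LINT x|lborel. (norm (indicator (K \<inter> ball 0 (real n)) x *\<^sub>R (z i - y)))\<^sup>2)"
        using K by (simp add: I_def norm_abs_L2 square_integrable_indicator C_borel)
      also have "\<dots> = (LINT x|lborel. (indicator (K \<inter> ball 0 (real n)) (x::'a) :: real) * (norm (z i - y))\<^sup>2)"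
        by (intro Bochner_Integration.integral_cong) (auto simp: indicator_def)
      finally show "(norm (I K (real n) (z i) - I K (real n) y))\<^sup>2 = c * (norm (z i - y))\<^sup>2"
        by (simp add: c_def)
    qed
    moreover have "(\<lambda>i. c * (norm (z i - y))\<^sup>2) \<longlonglongrightarrow> c * (norm (y - y))\<^sup>2"
      by (intro tendsto_intros z_lim)
    ultimately have "(\<lambda>i. (norm (I K (real n) (z i) - I K (real n) y))\<^sup>2) \<longlonglongrightarrow> 0"
      by simp
    from tendsto_real_sqrt[OF this] have "(\<lambda>i. norm (I K (real n) (z i) - I K (real n) y)) \<longlonglongrightarrow> 0"
      by simp
    then have "(\<lambda>i. I K (real n) (z i)) \<longlonglongrightarrow> I K (real n) y"
      by (simp only: tendsto_norm_zero_iff LIM_zero_iff)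
    moreover have "I K (real n) (z i) \<in> closure D" for i
    proof -
      have "I K (real n) (z i) \<in> G"
        unfolding G_def by (rule image_eqI[of _ _ "(K, n, z i)"]) (use K z(1) in auto)
      then have "sum_list [I K (real n) (z i)] \<in> D"
        unfolding D_def by (intro imageI) simp
      then show ?thesis using closure_subset[of D] by auto
    qed
    ultimately show ?thesis by (rule closure_limit[rotated])
  qed

  have W_ball: "A \<in> sets borel \<and> (\<forall>y. I A (real n) y \<in> closure D)" if "A \<in> sigma_sets UNIV C" for A n
    using C_Int C_Pow that
  proof (induction rule: sigma_sets_induct_disjoint)
    case (basic A)
    then show ?case using W_gen C_borel by blast
  next
    case empty
    have "I {} (real n) y = 0" for y
      by (simp add: I_def zero_L2_def)
    then show ?case using W_zero by simp
  next
    case (compl A)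
    then have A: "A \<in> sets borel" "\<And>y. I A (real n) y \<in> closure D" by auto
    have "I (UNIV - A) (real n) y = I UNIV (real n) y + I A (real n) (- y)" for y
    proof -
      have "I UNIV (real n) y + I A (real n) (- y) = abs_L2 (\<lambda>x. indicator (UNIV \<inter> ball 0 (real n)) x *\<^sub>R y
          + indicator (A \<inter> ball 0 (real n)) x *\<^sub>R (- y))"
        using A by (intro I_add) auto
      also have "\<dots> = I (UNIV - A) (real n) y"
        unfolding I_def by (intro arg_cong[of _ _ abs_L2] ext) (auto simp: indicator_def)
      finally show ?thesis by simp
    qed
    then show ?case
      using A W_add[OF W_gen[OF \<open>UNIV \<in> C\<close>]] by auto
  next
    case (union A)
    then have A: "A i \<in> sets borel" "I (A i) (real n) y \<in> closure D" for i y by auto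
    define S where "S k = (\<Union>i<k. A i)" for k
    have S: "S k \<in> sets borel" for k
      unfolding S_def using A by auto
    have S_W: "I (S k) (real n) y \<in> closure D" for k y
    proof (induction k)
      case 0
      have "I (S 0) (real n) y = 0"
        by (simp add: I_def S_def zero_L2_def)
      then show ?case by (simp only: W_zero)
    next
      case (Suc k)
      have disj: "x \<notin> A k" if x: "x \<in> S k" for x
      proof -
        obtain i where "i < k" "x \<in> A i" using x by (auto simp: S_def)
        then show ?thesis using disjoint_family_onD[OF union(1), of i k] by auto
      qed
      have "I (S k) (real n) y + I (A k) (real n) y = abs_L2 (\<lambda>x. indicator (S k \<inter> ball 0 (real n)) x *\<^sub>R y
          + indicator (A k \<inter> ball 0 (real n)) x *\<^sub>R y)"
        using A S by (intro I_add) auto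
      also have "\<dots> = I (S (Suc k)) (real n) y"
        unfolding I_def using disj
        by (intro arg_cong[of _ _ abs_L2] ext) (auto simp: indicator_def S_def lessThan_Suc)
      finally show ?case using W_add[OF Suc A(2)[of k y]] by simp
    qed
    have S_Union: "(\<Union>k. S k) = (\<Union>i. A i)"
      unfolding S_def by blast
    have A_Union: "(\<Union>i. A i) \<in> sets borel" using A by auto
    have "I (\<Union>i. A i) (real n) y \<in> closure D" for y
    proof (rule closure_limit[OF S_W])
      show "(\<lambda>k. I (S k) (real n) y) \<longlonglongrightarrow> I (\<Union>i. A i) (real n) y"
        unfolding I_def
      proof (rule abs_L2_tendsto_dominated(2))
        show "square_integrable (\<lambda>x. indicator ((\<Union>i. A i) \<inter> ball 0 (real n)) x *\<^sub>R y)"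
          by (rule square_integrable_indicator[OF A_Union])
        show "(\<lambda>x. indicator (S k \<inter> ball 0 (real n)) x *\<^sub>R y) \<in> borel_measurable lborel" for k
          using square_integrable_indicator[OF S] by (rule square_integrable_measurable)
        have "incseq S"
          unfolding S_def by (rule incseq_SucI) (auto simp: lessThan_Suc)
        then show "(\<lambda>k. indicator (S k \<inter> ball 0 (real n)) x *\<^sub>R y)
            \<longlonglongrightarrow> indicator ((\<Union>i. A i) \<inter> ball 0 (real n)) x *\<^sub>R y" for x
          unfolding S_Union[symmetric] by (rule indicator_scaleR_tendsto)
        show "norm (indicator (S k \<inter> ball 0 (real n)) x *\<^sub>R y)
            \<le> 2 * norm (indicator ((\<Union>i. A i) \<inter> ball 0 (real n)) x *\<^sub>R y)" for k x
          by (auto simp: indicator_def S_def)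
      qed
    qed
    then show ?case using A_Union by blast
  qed

  have W_indicator: "abs_L2 (\<lambda>x. indicator A x *\<^sub>R y) \<in> closure D"
    if A: "A \<in> sets borel" and si: "square_integrable (\<lambda>x. indicator A x *\<^sub>R y)" for A y
  proof (rule closure_limit)
    show "I A (real n) y \<in> closure D" for n
      using W_ball[OF borel_C[OF A]] by blast
    show "(\<lambda>n. I A (real n) y) \<longlonglongrightarrow> abs_L2 (\<lambda>x. indicator A x *\<^sub>R y)"
      unfolding I_def
    proof (rule abs_L2_tendsto_dominated(2)[OF si])
      show "(\<lambda>x. indicator (A \<inter> ball 0 (real n)) x *\<^sub>R y) \<in> borel_measurable lborel" for n
        using square_integrable_indicator[OF A] by (rule square_integrable_measurable)
      have "incseq (\<lambda>n. ball (0::'a) (real n))"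
        by (intro incseq_SucI subset_ball) auto
      from indicator_scaleR_tendsto[OF this, of A _ y]
      have "(\<lambda>n. indicator (ball 0 (real n) \<inter> A) x *\<^sub>R y) \<longlonglongrightarrow> indicator ((\<Union>n. ball 0 (real n)) \<inter> A) x *\<^sub>R y" for x .
      moreover have "(\<Union>n. ball (0::'a) (real n)) = UNIV"
        by (auto intro: reals_Archimedean2)
      ultimately show "(\<lambda>n. indicator (A \<inter> ball 0 (real n)) x *\<^sub>R y) \<longlonglongrightarrow> indicator A x *\<^sub>R y" for x
        by (simp add: Int_commute)
      show "norm (indicator (A \<inter> ball 0 (real n)) x *\<^sub>R y) \<le> 2 * norm (indicator A x *\<^sub>R y)" for n x
        by (auto simp: indicator_def)
    qed
  qed

  have W_simple: "abs_L2 s \<in> closure D" if s: "simple_function lborel s" "square_integrable s" for s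
  proof -
    note [measurable] = s(2)
    have level: "s -` {y} \<in> sets borel" for y
      using simple_functionD(2)[OF s(1), of "{y}"] by simp
    define g where "g y x = indicator (s -` {y}) x *\<^sub>R y" for x y
    have si: "square_integrable (g y)" for y
    proof (rule square_integrable_bound[where g="\<lambda>x. (norm (s x))\<^sup>2"])
      show "g y \<in> borel_measurable lborel"
        unfolding g_def using level[of y] by auto
    qed (use s in \<open>auto simp: square_integrable_def indicator_def g_def\<close>)
    have g_W: "abs_L2 (g y) \<in> closure D" for y
      using W_indicator[OF level[of y], of y] si[of y] by (simp only: g_def[abs_def])
    have sum: "square_integrable (\<lambda>x. \<Sum>y\<in>F. g y x) \<and> abs_L2 (\<lambda>x. \<Sum>y\<in>F. g y x) \<in> closure D"
      if "finite F" for F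
      using that
    proof (induction F)
      case empty
      have "abs_L2 (\<lambda>x. \<Sum>y\<in>{}. g y x) = 0" by (simp add: zero_L2_def)
      then show ?case using W_zero by (simp add: square_integrable_zero)
    next
      case (insert y F)
      then have *: "square_integrable (\<lambda>x. \<Sum>y\<in>F. g y x)" "abs_L2 (\<lambda>x. \<Sum>y\<in>F. g y x) \<in> closure D"
        and sum_insert: "(\<lambda>x. \<Sum>y\<in>insert y F. g y x) = (\<lambda>x. g y x + (\<Sum>y\<in>F. g y x))" by auto
      show ?case
        unfolding sum_insert
        using square_integrable_add[OF si *(1)] W_add[OF g_W *(2), of y] abs_L2_add[OF si *(1), of y] by simp
    qed
    have fin: "finite (range s)"
      using simple_functionD(1)[OF s(1)] by simp
    have "(\<Sum>y\<in>range s. g y x) = s x" for x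
    proof -
      have "(\<Sum>y\<in>range s. g y x) = (\<Sum>y\<in>range s. if s x = y then y else 0)"
        by (intro sum.cong) (auto simp: g_def indicator_def)
      then show ?thesis using fin by simp
    qed
    then show ?thesis using sum[OF fin] by simp
  qed

  have "u \<in> closure D" for u
  proof -
    have f: "square_integrable (rep_L2 u)" by (rule square_integrable_rep_L2)
    obtain F where F: "\<And>i. simple_function lborel (F i)" "\<And>x. (\<lambda>i. F i x) \<longlonglongrightarrow> rep_L2 u x"
      "\<And>i x. norm (F i x) \<le> 2 * norm (rep_L2 u x)"
      using borel_measurable_implies_sequence_metric[OF square_integrable_measurable[OF f], of 0] by auto
    have Fm: "F i \<in> borel_measurable lborel" for i
      using F(1) by (rule borel_measurable_simple_function)
    note lim = abs_L2_tendsto_dominated[OF f Fm F(2,3)]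
    show ?thesis
      using closure_limit[OF W_simple[OF F(1) lim(1)] lim(2)] by (simp add: abs_rep_L2)
  qed
  with \<open>countable D\<close> show ?thesis by blast
qed

instance L2 :: (euclidean_space, "{real_inner, second_countable_topology}") second_countable_topology
proof
  obtain D :: "('a, 'b) L2 set" where D: "countable D" "closure D = UNIV"
    using ex_countable_dense_L2 by blast
  define B where "B = (\<lambda>(d, n). ball d (1 / Suc n)) ` (D \<times> (UNIV::nat set))"
  have "topological_basis B"
  proof (rule topological_basisI)
    fix U and u :: "('a, 'b) L2" assume "open U" "u \<in> U"
    then obtain e where e: "0 < e" "ball u e \<subseteq> U" using open_contains_ball by blast
    obtain n where n: "1 / Suc n < e / 2" using nat_approx_posE[of "e / 2"] e(1) by auto
    obtain d where d: "d \<in> D" "dist d u < 1 / Suc n"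
      using D(2) closure_approachable[of u D] by (metis UNIV_I of_nat_0_less_iff zero_less_Suc zero_less_divide_1_iff)
    have "ball d (1 / Suc n) \<subseteq> ball u e"
    proof
      fix v assume "v \<in> ball d (1 / Suc n)"
      then show "v \<in> ball u e"
        using dist_triangle[of u v d] d(2) n by (simp add: dist_commute)
    qed
    then show "\<exists>b\<in>B. u \<in> b \<and> b \<subseteq> U"
      using d e by (intro bexI[of _ "ball d (1 / Suc n)"]) (auto simp: B_def)
  qed (auto simp: B_def)
  moreover have "countable B"
    unfolding B_def using D(1) by auto
  ultimately show "\<exists>B :: ('a, 'b) L2 set set. countable B \<and> open = generate_topology B"
    using topological_basis_imp_subbasis by blast
qed

text \<open>
  Functions on \<open>S\<close> with values in \<open>V\<close>, extended by zero outside \<open>S\<close>: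
  \<open>L2_on \<Omega> UNIV\<close> is \<open>L\<^sup>2(\<Omega>)\<close> and \<open>L2_on {0<..<T} (L2_on \<Omega> UNIV)\<close> is \<open>L\<^sup>2(0,T;L\<^sup>2(\<Omega>))\<close>.
\<close>

definition L2_on :: "'a set \<Rightarrow> 'b set \<Rightarrow> ('a::euclidean_space, 'b::{real_inner, second_countable_topology}) L2 set" where
  "L2_on S V = {u. AE x in lborel. (x \<in> S \<longrightarrow> rep_L2 u x \<in> V) \<and> (x \<notin> S \<longrightarrow> rep_L2 u x = 0)}"

text \<open>The class of a function given on \<open>S\<close>; meaningful if its extension by zero is square integrable.\<close>

definition class_on :: "'a set \<Rightarrow> ('a \<Rightarrow> 'b) \<Rightarrow> ('a::euclidean_space, 'b::{real_inner, second_countable_topology}) L2" where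
  "class_on S h = abs_L2 (\<lambda>x. indicator S x *\<^sub>R h x)"


section \<open>The Dirichlet Laplacian\<close>

primrec continuously_differentiable :: "nat \<Rightarrow> ('a::euclidean_space \<Rightarrow> real) \<Rightarrow> bool" where
  "continuously_differentiable 0 v \<longleftrightarrow> continuous_on UNIV v"
| "continuously_differentiable (Suc k) v \<longleftrightarrow> (\<forall>x. v differentiable (at x)) \<and>
    (\<forall>i\<in>Basis. continuously_differentiable k (\<lambda>x. frechet_derivative v (at x) i))"

definition test_function :: "'a::euclidean_space set \<Rightarrow> ('a \<Rightarrow> real) \<Rightarrow> bool" where
  "test_function \<Omega> v \<longleftrightarrow> (\<forall>k. continuously_differentiable k v) \<and>
    compact (closure {x. v x \<noteq> 0}) \<and> closure {x. v x \<noteq> 0} \<subseteq> \<Omega>"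

definition gradient :: "('a::euclidean_space \<Rightarrow> real) \<Rightarrow> 'a \<Rightarrow> 'a" where
  "gradient v x = (\<Sum>i\<in>Basis. frechet_derivative v (at x) i *\<^sub>R i)"

text \<open>
  The pairs \<open>(u, \<nabla>u)\<close> with \<open>u \<in> H\<^sup>1\<^sub>0(\<Omega>)\<close>: the norm of the product space restricted to pairs
  \<open>(v, \<nabla>v)\<close> is the \<open>H\<^sup>1\<close> norm of \<open>v\<close>.
\<close>

definition H01_graph :: "'a::euclidean_space set \<Rightarrow> (('a, real) L2 \<times> ('a, 'a) L2) set" where
  "H01_graph \<Omega> = closure {(abs_L2 v, abs_L2 (gradient v)) | v. test_function \<Omega> v}"

text \<open>
  The graph of \<open>-\<Delta>\<close> with homogeneous Dirichlet boundary conditions, in the weak sense: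
  \<open>u \<in> H\<^sup>1\<^sub>0(\<Omega>)\<close> and \<open>-\<Delta>u = h \<in> L\<^sup>2(\<Omega>)\<close>.
\<close>

definition dirichlet_laplacian :: "'a::euclidean_space set \<Rightarrow> (('a, real) L2 \<times> ('a, real) L2) set" where
  "dirichlet_laplacian \<Omega> = {(u, h). h \<in> L2_on \<Omega> UNIV \<and>
    (\<exists>p. (u, p) \<in> H01_graph \<Omega> \<and>
      (\<forall>v. test_function \<Omega> v \<longrightarrow> inner p (abs_L2 (gradient v)) = inner h (abs_L2 v)))}"

definition orthonormal_basis :: "'h::real_inner set \<Rightarrow> (nat \<Rightarrow> 'h) \<Rightarrow> bool" where
  "orthonormal_basis V \<phi> \<longleftrightarrow>
    (\<forall>m n. inner (\<phi> m) (\<phi> n) = (if m = n then 1 else 0)) \<and> closure (span (range \<phi>)) = V"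

text \<open>
  The converse of the graph of \<open>A = -\<Delta>\<close> is the graph of \<open>A\<^sup>-\<^sup>1\<close>,
  so the last condition is \<open>A\<^sup>-\<^sup>1 \<phi>\<^sub>m = \<mu>\<^sub>m \<phi>\<^sub>m\<close>.
\<close>

definition inverse_laplacian_eigensystem ::
    "'a::euclidean_space set \<Rightarrow> (nat \<Rightarrow> real) \<Rightarrow> (nat \<Rightarrow> ('a, real) L2) \<Rightarrow> bool" where
  "inverse_laplacian_eigensystem \<Omega> \<mu> \<phi> \<longleftrightarrow> orthonormal_basis (L2_on \<Omega> UNIV) \<phi> \<and>
    (\<forall>m. (\<phi> m, \<mu> m *\<^sub>R \<phi> m) \<in> (dirichlet_laplacian \<Omega>)\<inverse>)"


section \<open>The transformed normal operator\<close>

text \<open>\<open>F(A)\<close>, where \<open>A \<phi>\<^sub>m = (1/\<mu>\<^sub>m) \<phi>\<^sub>m\<close>.\<close>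

definition spectral_calculus ::
    "(nat \<Rightarrow> real) \<Rightarrow> (nat \<Rightarrow> 'h) \<Rightarrow> (real \<Rightarrow> real) \<Rightarrow> 'h \<Rightarrow> 'h::real_inner" where
  "spectral_calculus \<mu> \<phi> F u = (\<Sum>m. (F (1 / \<mu> m) * inner u (\<phi> m)) *\<^sub>R \<phi> m)"

definition heat_semigroup :: "(nat \<Rightarrow> real) \<Rightarrow> (nat \<Rightarrow> 'h) \<Rightarrow> real \<Rightarrow> 'h \<Rightarrow> 'h::real_inner" where
  "heat_semigroup \<mu> \<phi> t = spectral_calculus \<mu> \<phi> (\<lambda>a. exp (- a * t))"

text \<open>
  The value at time \<open>t\<close> of \<open>e\<^bsup>-A(T-\<cdot>)\<^esup> A\<^bsup>1/2\<^esup> \<integral> e\<^bsup>-A(T-s)\<^esup> A\<^bsup>1/2\<^esup> f(s) ds\<close>, given by its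
  Fourier coefficients; literally the integrand makes sense only for \<open>f(s)\<close> in the domain of \<open>A\<^bsup>1/2\<^esup>\<close>.
\<close>

definition heat_final_term ::
    "real \<Rightarrow> (nat \<Rightarrow> real) \<Rightarrow> (nat \<Rightarrow> 'h) \<Rightarrow> (real, 'h) L2 \<Rightarrow> real \<Rightarrow> 'h::{real_inner, second_countable_topology}" where
  "heat_final_term T \<mu> \<phi> f t = (\<Sum>m. (1 / \<mu> m * exp (- (1 / \<mu> m) * (T - t)) *
    (LINT s:{0<..<T}|lborel. exp (- (1 / \<mu> m) * (T - s)) * inner (rep_L2 f s) (\<phi> m))) *\<^sub>R \<phi> m)"

definition normal_operator ::
    "real \<Rightarrow> (nat \<Rightarrow> real) \<Rightarrow> (nat \<Rightarrow> 'h) \<Rightarrow> (real, 'h) L2 \<times> 'h \<Rightarrow>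
      (real, 'h) L2 \<times> 'h::{real_inner, banach, second_countable_topology}" where
  "normal_operator T \<mu> \<phi> = (\<lambda>(f, g).
    (class_on {0<..<T} (\<lambda>t. rep_L2 f t + heat_final_term T \<mu> \<phi> f t + g + heat_semigroup \<mu> \<phi> (T - t) g),
     (LINT s:{0<..<T}|lborel. rep_L2 f s)
       + (LINT s:{0<..<T}|lborel. heat_semigroup \<mu> \<phi> (T - s) (rep_L2 f s))
       + T *\<^sub>R g + spectral_calculus \<mu> \<phi> (\<lambda>a. 1 / a) g))"

definition state_space :: "real \<Rightarrow> 'a::euclidean_space set \<Rightarrow> ((real, ('a, real) L2) L2 \<times> ('a, real) L2) set" where
  "state_space T \<Omega> = L2_on {0<..<T} (L2_on \<Omega> UNIV) \<times> L2_on \<Omega> UNIV"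

definition eigenspace :: "'v set \<Rightarrow> ('v \<Rightarrow> 'v) \<Rightarrow> real \<Rightarrow> 'v::real_vector set" where
  "eigenspace V F c = {z \<in> V. F z = c *\<^sub>R z}"

definition is_eigenvalue :: "'v::real_vector set \<Rightarrow> ('v \<Rightarrow> 'v) \<Rightarrow> real \<Rightarrow> bool" where
  "is_eigenvalue V F c \<longleftrightarrow> (\<exists>z\<in>eigenspace V F c. z \<noteq> 0)"

definition infinite_dimensional :: "'v::real_vector set \<Rightarrow> bool" where
  "infinite_dimensional E \<longleftrightarrow> \<not> (\<exists>B. finite B \<and> E \<subseteq> span B)"

definition alpha :: "real \<Rightarrow> real \<Rightarrow> real" where
  "alpha T m = m - 1/2 * exp (- (2 * T) / m)"

definition beta :: "real \<Rightarrow> real \<Rightarrow> real" where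
  "beta T m = 2 * m * exp (- T / m) - 1/2 * (T + 1) * exp (- (2 * T) / m)"

end

theory Submission
  imports Defs
begin

text \<open>
  In the basis \<open>\<phi>\<^sub>m\<close> the operator decouples: with \<open>e\<^sub>m(t) = exp (-(T-t)/\<mu>\<^sub>m)\<close> (called \<open>decay m t\<close> below) the equation for an
  eigenpair \<open>(f, g)\<close> with eigenvalue \<open>l\<close> becomes, for the coefficients \<open>h = \<langle>f(\<cdot>), \<phi>\<^sub>m\<rangle>\<close> and
  \<open>g = \<langle>g, \<phi>\<^sub>m\<rangle>\<close>,
  \<open>h + (1/\<mu>\<^sub>m) F e\<^sub>m + g + g e\<^sub>m = l h\<close> and \<open>\<integral>h + F + T g + \<mu>\<^sub>m g = l g\<close>, where \<open>F = \<integral>e\<^sub>m h\<close>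
  (lemmas \<open>normal_operator_modes\<close> and \<open>eigen_iff\<close>). The analytic content of this step is that
  the series defining the operator converge and define square integrable functions; the factor
  \<open>1/\<mu>\<^sub>m\<close>, unbounded in \<open>m\<close>, is paid for by \<open>\<integral>e\<^sub>m\<^sup>2 \<le> \<mu>\<^sub>m/2\<close>.

  If \<open>l = 1\<close>, then \<open>h\<close> cancels and a linear combination of \<open>1\<close> and \<open>e\<^sub>m\<close> vanishes. These
  functions are linearly independent, so \<open>g = 0\<close>, \<open>F = 0\<close> and \<open>\<integral>h = 0\<close> (\<open>mode_eq_one\<close>).
  Hence the eigenspace consists of the \<open>f\<close> all of whose coefficients are orthogonal to \<open>1\<close> and
  \<open>e\<^sub>m\<close>. It is closed, and the partial sums of the Fourier expansion of such an \<open>f\<close> lie in the span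
  of the functions \<open>\<psi> \<phi>\<^sub>m\<close> of the claim (\<open>moment_free_eq_closure_span\<close>). One nonzero
  \<open>\<psi>\<close> in every mode makes it infinite-dimensional.

  If \<open>l \<noteq> 1\<close>, the first equation gives \<open>h = (g + c e\<^sub>m)/(l-1)\<close> with \<open>c = F/\<mu>\<^sub>m + g\<close>, and what remains
  are two homogeneous linear equations in \<open>(g, c)\<close>. With \<open>q = exp (-T/\<mu>\<^sub>m)\<close> their determinant is the cubic
  \<open>(l - A)(l\<^sup>2 - l(1+T+\<mu>\<^sub>m) + \<mu>\<^sub>m q) - (l - q) \<mu>\<^sub>m (1-q)(3+q)/2\<close>, \<open>A = (3-q\<^sup>2)/2\<close>, which
  expands to the cubic of the claim (\<open>charpoly_det\<close>). Its value at \<open>1\<close> is positive, so no root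
  coincides with the eigenvalue \<open>1\<close>.

  From this form the signs of the cubic at \<open>0 < q < A\<close> and at a large argument can be read off: they
  are \<open>-, +, -, +\<close>. So there are three real roots \<open>0 < l\<^sub>1 < q < l\<^sub>3 < A < l\<^sub>2\<close>, and \<open>l\<^sub>1 \<longlongrightarrow> 0\<close>
  because \<open>q \<longlongrightarrow> 0\<close>. The sum and the product of the other two are then determined in the limit
  by the coefficients, which fixes their limits, and \<open>l\<^sub>1 l\<^sub>2 l\<^sub>3 = \<mu>\<^sub>m q\<^sup>2\<close> yields the rate for \<open>l\<^sub>1\<close>
  (\<open>charpoly_roots\<close>, \<open>charpoly_roots_tendsto\<close>).
\<close>

section \<open>Orthonormal systems in a Hilbert space\<close>

locale orthonormal_system =
  fixes \<phi> :: "nat \<Rightarrow> 'h::{real_inner, banach, second_countable_topology}"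
  assumes orthonormal: "inner (\<phi> m) (\<phi> n) = (if m = n then 1 else 0)"
begin

definition closed_span where "closed_span = closure (span (range \<phi>))"

lemma subspace_closed_span: "subspace closed_span"
  unfolding closed_span_def subspace_def
proof (intro conjI ballI allI)
  show "0 \<in> closure (span (range \<phi>))"
    using closure_subset span_zero by blast
  show "x + y \<in> closure (span (range \<phi>))"
    if "x \<in> closure (span (range \<phi>))" "y \<in> closure (span (range \<phi>))" for x y
    using that by (intro closure_add) (auto intro: span_add)
  show "c *\<^sub>R x \<in> closure (span (range \<phi>))" if "x \<in> closure (span (range \<phi>))" for x c
  proof -
    have "(\<lambda>x. c *\<^sub>R x) ` span (range \<phi>) \<subseteq> span (range \<phi>)" by (auto intro: span_scale)
    then show ?thesis
      using that closure_mono[of "(\<lambda>x. c *\<^sub>R x) ` span (range \<phi>)" "span (range \<phi>)"]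
      by (auto simp flip: closure_scaleR)
  qed
qed

lemma closed_closed_span: "closed closed_span"
  by (simp add: closed_span_def)

lemma basis_in_closed_span: "\<phi> m \<in> closed_span"
  unfolding closed_span_def using closure_subset span_base by (metis rangeI subsetD)

lemma norm_sum_basis: "finite I \<Longrightarrow> (norm (\<Sum>i\<in>I. c i *\<^sub>R \<phi> i))\<^sup>2 = (\<Sum>i\<in>I. (c i)\<^sup>2)"
proof -
  assume "finite I"
  then have "(norm (\<Sum>i\<in>I. c i *\<^sub>R \<phi> i))\<^sup>2 = (\<Sum>i\<in>I. (norm (c i *\<^sub>R \<phi> i))\<^sup>2)"
    by (intro norm_sum_Pythagorean) (auto simp: pairwise_def orthogonal_def orthonormal)
  also have "\<dots> = (\<Sum>i\<in>I. (c i)\<^sup>2)"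
    by (simp add: norm_eq_sqrt_inner orthonormal power_mult_distrib)
  finally show ?thesis .
qed

lemma summable_series:
  assumes "summable (\<lambda>m. (c m)\<^sup>2)"
  shows "summable (\<lambda>m. c m *\<^sub>R \<phi> m)"
  unfolding summable_Cauchy
proof (intro allI impI)
  fix e :: real assume "e > 0"
  then obtain N where N: "\<And>m n. m \<ge> N \<Longrightarrow> norm (\<Sum>i\<in>{m..<n}. (c i)\<^sup>2) < e\<^sup>2"
    using assms unfolding summable_Cauchy by (meson zero_less_power)
  have "norm (\<Sum>i\<in>{m..<n}. c i *\<^sub>R \<phi> i) < e" if "m \<ge> N" for m n
  proof (rule power_less_imp_less_base[where n=2])
    show "(norm (\<Sum>i\<in>{m..<n}. c i *\<^sub>R \<phi> i))\<^sup>2 < e\<^sup>2"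
      using N[OF that, of n] by (simp add: norm_sum_basis)
  qed (use \<open>e > 0\<close> in simp)
  then show "\<exists>N. \<forall>m\<ge>N. \<forall>n. norm (\<Sum>i\<in>{m..<n}. c i *\<^sub>R \<phi> i) < e" by blast
qed

lemma inner_sum_basis: "inner (\<Sum>i<n. c i *\<^sub>R \<phi> i) (\<phi> k) = (if k < n then c k else 0)"
proof -
  have "inner (\<Sum>i<n. c i *\<^sub>R \<phi> i) (\<phi> k) = (\<Sum>i<n. if i = k then c i else 0)"
    by (simp add: inner_sum_left orthonormal if_distrib cong: if_cong)
  then show ?thesis by simp
qed

lemma inner_series:
  assumes "summable (\<lambda>m. (c m)\<^sup>2)"
  shows "inner (\<Sum>m. c m *\<^sub>R \<phi> m) (\<phi> k) = c k"
proof -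
  have "(\<lambda>n. inner (\<Sum>i<n. c i *\<^sub>R \<phi> i) (\<phi> k)) \<longlonglongrightarrow> inner (\<Sum>m. c m *\<^sub>R \<phi> m) (\<phi> k)"
    by (intro tendsto_intros summable_LIMSEQ summable_series assms)
  moreover have "(\<lambda>n. inner (\<Sum>i<n. c i *\<^sub>R \<phi> i) (\<phi> k)) \<longlonglongrightarrow> c k"
    by (rule tendsto_eventually) (auto simp: inner_sum_basis eventually_sequentially intro!: exI[of _ "Suc k"])
  ultimately show ?thesis by (rule LIMSEQ_unique)
qed

lemma norm_series:
  assumes "summable (\<lambda>m. (c m)\<^sup>2)"
  shows "(norm (\<Sum>m. c m *\<^sub>R \<phi> m))\<^sup>2 = (\<Sum>m. (c m)\<^sup>2)"
proof (rule LIMSEQ_unique)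
  show "(\<lambda>n. (norm (\<Sum>i<n. c i *\<^sub>R \<phi> i))\<^sup>2) \<longlonglongrightarrow> (norm (\<Sum>m. c m *\<^sub>R \<phi> m))\<^sup>2"
    by (intro tendsto_intros summable_LIMSEQ summable_series assms)
  show "(\<lambda>n. (norm (\<Sum>i<n. c i *\<^sub>R \<phi> i))\<^sup>2) \<longlonglongrightarrow> (\<Sum>m. (c m)\<^sup>2)"
    by (simp add: norm_sum_basis summable_LIMSEQ assms)
qed

lemma partial_sum_in_closed_span: "(\<Sum>i<n. c i *\<^sub>R \<phi> i) \<in> closed_span"
  by (intro subspace_sum subspace_closed_span subspace_scale basis_in_closed_span)

lemma series_in_closed_span:
  assumes "summable (\<lambda>m. (c m)\<^sup>2)"
  shows "(\<Sum>m. c m *\<^sub>R \<phi> m) \<in> closed_span"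
  using closed_closed_span partial_sum_in_closed_span summable_LIMSEQ[OF summable_series[OF assms]]
  by (rule closed_sequentially)

lemma norm_diff_partial_sum:
  "(norm (u - (\<Sum>i<n. inner u (\<phi> i) *\<^sub>R \<phi> i)))\<^sup>2 = (norm u)\<^sup>2 - (\<Sum>i<n. (inner u (\<phi> i))\<^sup>2)"
proof -
  let ?s = "\<Sum>i<n. inner u (\<phi> i) *\<^sub>R \<phi> i"
  have "inner u ?s = (\<Sum>i<n. (inner u (\<phi> i))\<^sup>2)"
    by (simp add: inner_sum_right power2_eq_square)
  moreover have "inner ?s ?s = (\<Sum>i<n. (inner u (\<phi> i))\<^sup>2)"
    using norm_sum_basis[of "{..<n}" "\<lambda>i. inner u (\<phi> i)"] by (simp add: power2_norm_eq_inner)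
  ultimately show ?thesis
    by (simp add: power2_norm_eq_inner inner_diff_left inner_diff_right inner_commute)
qed

lemma bessel_partial: "(\<Sum>i<n. (inner u (\<phi> i))\<^sup>2) \<le> (norm u)\<^sup>2"
  using norm_diff_partial_sum[of u n] zero_le_power2[of "norm (u - (\<Sum>i<n. inner u (\<phi> i) *\<^sub>R \<phi> i))"]
  by linarith

lemma bessel_summable: "summable (\<lambda>m. (inner u (\<phi> m))\<^sup>2)"
  by (rule summableI_nonneg_bounded[where x="(norm u)\<^sup>2"]) (auto simp: bessel_partial)

lemma zero_if_orthogonal:
  assumes "u \<in> closed_span" "\<And>m. inner u (\<phi> m) = 0"
  shows "u = 0"
proof -
  have "range \<phi> \<subseteq> {w. inner u w = 0}" using assms(2) by auto
  then have "span (range \<phi>) \<subseteq> {w. inner u w = 0}"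
    by (intro span_minimal) (auto simp: subspace_def inner_add_right)
  then have "closed_span \<subseteq> {w. inner u w = 0}"
    unfolding closed_span_def by (intro closure_minimal closed_hyperplane)
  then show ?thesis using assms(1) by auto
qed

lemma closed_span_eqI:
  assumes "u \<in> closed_span" "v \<in> closed_span" "\<And>m. inner u (\<phi> m) = inner v (\<phi> m)"
  shows "u = v"
  using zero_if_orthogonal[of "u - v"] assms by (simp add: subspace_diff subspace_closed_span inner_diff_left)

lemma expansion:
  assumes "u \<in> closed_span"
  shows "(\<lambda>m. inner u (\<phi> m) *\<^sub>R \<phi> m) sums u"
proof -
  have "(\<Sum>m. inner u (\<phi> m) *\<^sub>R \<phi> m) = u"
    by (rule closed_span_eqI) (auto simp: series_in_closed_span inner_series bessel_summable assms)
  then show ?thesis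
    using summable_sums[OF summable_series[OF bessel_summable, of u]] by simp
qed

text \<open>
  Testing the integral against the component of itself orthogonal to the closed span shows that
  this component vanishes.
\<close>

lemma integral_in_closed_span:
  assumes f: "integrable M f" and closed_span: "AE x in M. f x \<in> closed_span"
  shows "integral\<^sup>L M f \<in> closed_span"
proof -
  define x where "x = integral\<^sup>L M f"
  define p where "p = (\<Sum>m. inner x (\<phi> m) *\<^sub>R \<phi> m)"
  have p: "p \<in> closed_span" unfolding p_def by (rule series_in_closed_span[OF bessel_summable])
  have "range \<phi> \<subseteq> {w. inner (x - p) w = 0}"
    by (auto simp: inner_diff_left p_def inner_series bessel_summable)
  then have "span (range \<phi>) \<subseteq> {w. inner (x - p) w = 0}"
    by (intro span_minimal) (auto simp: subspace_def inner_add_right)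
  then have orth: "inner (x - p) w = 0" if "w \<in> closed_span" for w
    using that closure_minimal[OF _ closed_hyperplane] unfolding closed_span_def by blast
  have "inner (x - p) x = (LINT y|M. inner (x - p) (f y))"
    using f by (simp add: x_def)
  also have "\<dots> = (LINT y|M. 0)"
    using closed_span f by (intro integral_cong_AE) (auto elim!: eventually_mono simp: orth)
  finally have "inner (x - p) (x - p) = 0"
    by (simp add: inner_diff_right[of _ x] orth[OF p])
  then show ?thesis using p by (simp add: x_def)
qed

end

section \<open>Square integrable functions on a set\<close>

lemma L2_eqI: "(AE x in lborel. rep_L2 u x = rep_L2 v x) \<Longrightarrow> u = v"
  using abs_L2_cong[OF square_integrable_rep_L2 square_integrable_rep_L2, of u v] by (simp add: abs_rep_L2)

lemma rep_L2_zero: "AE x in lborel. rep_L2 0 x = 0"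
  unfolding zero_L2_def using rep_abs_L2[OF square_integrable_zero] by simp

lemma rep_L2_add: "AE x in lborel. rep_L2 (u + v) x = rep_L2 u x + rep_L2 v x"
  using rep_abs_L2[OF square_integrable_add[OF square_integrable_rep_L2[of u] square_integrable_rep_L2[of v]]]
  by (simp add: abs_L2_add[OF square_integrable_rep_L2 square_integrable_rep_L2, symmetric] abs_rep_L2)

lemma rep_L2_scaleR: "AE x in lborel. rep_L2 (c *\<^sub>R u) x = c *\<^sub>R rep_L2 u x"
  using rep_abs_L2[OF square_integrable_scaleR[OF square_integrable_rep_L2[of u], of c]]
  by (simp add: scaleR_L2.abs_eq[symmetric] square_integrable_rep_L2 abs_rep_L2)

lemma subspace_L2_on:
  assumes "subspace V"
  shows "subspace (L2_on S V)"
  unfolding subspace_def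
proof (intro conjI ballI allI)
  note V = subspace_0[OF assms] subspace_add[OF assms] subspace_scale[OF assms]
  show "0 \<in> L2_on S V"
    unfolding L2_on_def using rep_L2_zero by (auto elim!: eventually_mono simp: V)
  show "u + v \<in> L2_on S V" if "u \<in> L2_on S V" "v \<in> L2_on S V" for u v
    using that rep_L2_add[of u v] unfolding L2_on_def mem_Collect_eq
    by eventually_elim (auto simp: V)
  show "c *\<^sub>R u \<in> L2_on S V" if "u \<in> L2_on S V" for u c
    using that rep_L2_scaleR[of c u] unfolding L2_on_def mem_Collect_eq
    by eventually_elim (auto simp: V)
qed

text \<open>
  The distance of \<open>u(x)\<close> to \<open>V\<close> for \<open>x \<in> S\<close>, and \<open>norm (u(x))\<close> outside \<open>S\<close>, is bounded by
  \<open>norm (u(x) - v(x))\<close> for every \<open>v\<close> in the set. Its \<open>L\<^sup>2\<close> norm is therefore at most \<open>dist u v\<close>, hence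
  zero if \<open>u\<close> is a limit.
\<close>

lemma closed_L2_on:
  fixes S :: "'a::euclidean_space set" and V :: "'b::{real_inner, second_countable_topology} set"
  assumes V: "closed V" "V \<noteq> {}" and S [measurable]: "S \<in> sets borel"
  shows "closed (L2_on S V)"
proof -
  have "u \<in> L2_on S V" if u: "u \<in> closure (L2_on S V)" for u
  proof -
    define d where "d x = (if x \<in> S then infdist (rep_L2 u x) V else norm (rep_L2 u x))" for x
    have [measurable]: "rep_L2 v \<in> borel_measurable lborel" for v :: "('a, 'b) L2"
      using square_integrable_rep_L2 by (rule square_integrable_measurable)
    have [measurable]: "(\<lambda>y. infdist y V) \<in> borel_measurable borel"
      by (intro borel_measurable_continuous_onI continuous_intros)
    have dm [measurable]: "d \<in> borel_measurable lborel"
      unfolding d_def by measurable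
    have bound: "AE x in lborel. (d x)\<^sup>2 \<le> (norm (rep_L2 u x - rep_L2 v x))\<^sup>2" if "v \<in> L2_on S V" for v
      using that unfolding L2_on_def mem_Collect_eq
    proof eventually_elim
      case (elim x)
      have "d x \<le> norm (rep_L2 u x - rep_L2 v x)"
        using elim infdist_le[of "rep_L2 v x" V "rep_L2 u x"] by (auto simp: d_def dist_norm)
      then show ?case
        by (intro power_mono) (auto simp: d_def infdist_nonneg)
    qed
    have int_diff: "integrable lborel (\<lambda>x. (norm (rep_L2 u x - rep_L2 v x))\<^sup>2)" for v
      using square_integrable_diff[OF square_integrable_rep_L2[of u] square_integrable_rep_L2[of v]]
      by (simp add: square_integrable_def)
    obtain v0 where v0: "v0 \<in> L2_on S V"
      using u by (metis closure_empty empty_iff equals0I)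
    have int_d: "integrable lborel (\<lambda>x. (d x)\<^sup>2)"
      by (rule Bochner_Integration.integrable_bound[OF int_diff[of v0]]) (use bound[OF v0] in auto)
    have le: "(LINT x|lborel. (d x)\<^sup>2) \<le> (dist u v)\<^sup>2" if "v \<in> L2_on S V" for v
      unfolding dist_L2_rep by (rule integral_mono_AE[OF int_d int_diff bound[OF that]])
    have "(LINT x|lborel. (d x)\<^sup>2) \<le> 0"
    proof (rule field_le_epsilon)
      fix e :: real assume "e > 0"
      then obtain v where v: "v \<in> L2_on S V" "dist v u < sqrt e"
        using u unfolding closure_approachable by (meson real_sqrt_gt_zero)
      have "(dist u v)\<^sup>2 \<le> (sqrt e)\<^sup>2"
        using v(2) by (intro power_mono) (auto simp: dist_commute)
      then show "(LINT x|lborel. (d x)\<^sup>2) \<le> 0 + e"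
        using le[OF v(1)] \<open>e > 0\<close> by simp
    qed
    moreover have "0 \<le> (LINT x|lborel. (d x)\<^sup>2)" by simp
    ultimately have "(LINT x|lborel. (d x)\<^sup>2) = 0" by linarith
    then have "AE x in lborel. (d x)\<^sup>2 = 0"
      by (subst (asm) integral_nonneg_eq_0_iff_AE[OF int_d]) auto
    then show ?thesis
      unfolding L2_on_def mem_Collect_eq
      by eventually_elim (auto simp: d_def in_closed_iff_infdist_zero[OF V] split: if_splits)
  qed
  then show ?thesis
    using closure_subset_eq by blast
qed

lemma rep_class_on:
  assumes "square_integrable (\<lambda>x. indicator S x *\<^sub>R h x)"
  shows "AE x in lborel. rep_L2 (class_on S h) x = indicator S x *\<^sub>R h x"
  unfolding class_on_def by (rule rep_abs_L2[OF assms])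

lemma class_on_in_L2_on:
  assumes "square_integrable (\<lambda>x. indicator S x *\<^sub>R h x)" "AE x in lborel. x \<in> S \<longrightarrow> h x \<in> V"
  shows "class_on S h \<in> L2_on S V"
  unfolding L2_on_def mem_Collect_eq using rep_class_on[OF assms(1)] assms(2)
  by eventually_elim auto

lemma inner_class_on:
  assumes "square_integrable (\<lambda>x. indicator S x *\<^sub>R h x)"
  shows "inner u (class_on S h) = (LINT x:S|lborel. inner (rep_L2 u x) (h x))"
proof -
  have "inner (abs_L2 (rep_L2 u)) (class_on S h) = (LINT x|lborel. inner (rep_L2 u x) (indicator S x *\<^sub>R h x))"
    unfolding class_on_def using assms by (simp add: inner_L2.abs_eq square_integrable_rep_L2)
  then show ?thesis by (simp add: abs_rep_L2 set_lebesgue_integral_def)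
qed

lemma square_integrable_imp_set_integrable:
  fixes f :: "'a::euclidean_space \<Rightarrow> 'b::{real_inner, banach, second_countable_topology}"
  assumes f: "square_integrable (\<lambda>x. indicator S x *\<^sub>R f x)" and S: "S \<in> sets borel" "bounded S"
  shows "set_integrable lborel S f"
  unfolding set_integrable_def
proof (rule Bochner_Integration.integrable_bound)
  have "emeasure lborel S < \<infinity>" using S(2) by (rule emeasure_bounded_finite)
  then show "integrable lborel (\<lambda>x. indicator S x + (norm (indicator S x *\<^sub>R f x))\<^sup>2 :: real)"
    using f S(1) by (intro Bochner_Integration.integrable_add) (auto simp: square_integrable_def)
  show "AE x in lborel. norm (indicator S x *\<^sub>R f x) \<le> norm (indicator S x + (norm (indicator S x *\<^sub>R f x))\<^sup>2 :: real)"
  proof (rule AE_I2)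
    fix x
    have "y \<le> 1 + y\<^sup>2" for y :: real
      using sum_squares_bound[of y 1] zero_le_power2[of y] unfolding mult_1_right power_one by linarith
    then show "norm (indicator S x *\<^sub>R f x) \<le> norm (indicator S x + (norm (indicator S x *\<^sub>R f x))\<^sup>2 :: real)"
      by (auto simp: indicator_def)
  qed
qed (use f in \<open>auto simp: square_integrable_def\<close>)

lemma square_integrable_restrict:
  assumes "square_integrable f" "S \<in> sets borel"
  shows "square_integrable (\<lambda>x. indicator S x *\<^sub>R f x)"
proof (rule square_integrable_bound)
  show "integrable lborel (\<lambda>x. (norm (f x))\<^sup>2)" using assms(1) by (simp add: square_integrable_def)
qed (use assms in \<open>auto simp: indicator_def square_integrable_def\<close>)

lemma set_integral_FTC:
  fixes F f :: "real \<Rightarrow> real"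
  assumes "a \<le> b" "continuous_on UNIV f" "\<And>x. (F has_real_derivative f x) (at x)"
  shows "(LINT x:{a<..<b}|lborel. f x) = F b - F a"
proof -
  have "(LBINT x=a..b. f x) = F b - F a"
    by (rule interval_integral_FTC_finite)
      (use assms in \<open>auto intro: continuous_on_subset has_vector_derivative_at_within
        simp: has_real_derivative_iff_has_vector_derivative\<close>)
  then show ?thesis
    using assms(1) by (simp add: interval_integral_Ioo)
qed

lemma set_integral_exp:
  fixes a b k T :: real
  assumes "a \<le> b" "k \<noteq> 0"
  shows "(LINT t:{a<..<b}|lborel. exp (- k * (T - t))) = (exp (- k * (T - b)) - exp (- k * (T - a))) / k"
  unfolding diff_divide_distrib
  by (rule set_integral_FTC) (use assms in \<open>auto intro!: continuous_intros derivative_eq_intros\<close>)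

lemma Cauchy_Schwarz_integral:
  fixes u v :: "'a::euclidean_space \<Rightarrow> real"
  assumes "square_integrable u" "square_integrable v"
  shows "(LINT x|lborel. u x * v x)\<^sup>2 \<le> (LINT x|lborel. (u x)\<^sup>2) * (LINT x|lborel. (v x)\<^sup>2)"
  using Cauchy_Schwarz_ineq[of "abs_L2 u" "abs_L2 v"] assms
  by (simp add: inner_L2.abs_eq power2_eq_square)

lemma square_integrable_bounded_on:
  fixes h :: "'a::euclidean_space \<Rightarrow> 'b::{real_inner, second_countable_topology}"
  assumes [measurable]: "h \<in> borel_measurable borel" "S \<in> sets borel"
    and S: "bounded S" and h: "\<And>x. x \<in> S \<Longrightarrow> norm (h x) \<le> C"
  shows "square_integrable (\<lambda>x. indicator S x *\<^sub>R h x)"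
proof (rule square_integrable_bound)
  show "integrable lborel (\<lambda>x. indicator S x * C\<^sup>2 :: real)"
    using emeasure_bounded_finite[OF S] by (intro integrable_mult_left) (simp add: integrable_indicator_iff)
  show "AE x in lborel. (norm (indicator S x *\<^sub>R h x))\<^sup>2 \<le> indicator S x * C\<^sup>2"
    using h by (intro AE_I2) (auto simp: indicator_def intro!: power_mono)
qed simp

lemma AE_interval_ex:
  fixes a b :: real
  assumes "AE t in lborel. t \<in> {a<..<b} \<longrightarrow> P t" "a < b"
  shows "\<exists>t\<in>{a<..<b}. P t"
proof (rule ccontr)
  assume "\<not> ?thesis"
  with assms(1) have "AE t in lborel. t \<notin> {a<..<b}"
    by (auto elim!: eventually_mono)
  then have "emeasure lborel {a<..<b} = 0"
    by (subst (asm) AE_iff_measurable[of "{a<..<b}"]) auto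
  then show False using assms(2) by simp
qed

lemma square_integrable_continuous:
  fixes h :: "'a::euclidean_space \<Rightarrow> 'b::{real_inner, second_countable_topology}"
  assumes h: "continuous_on UNIV h" and S: "S \<in> sets borel" "bounded S"
  shows "square_integrable (\<lambda>x. indicator S x *\<^sub>R h x)"
proof -
  have "compact (h ` closure S)"
    using S(2) by (intro compact_continuous_image continuous_on_subset[OF h]) auto
  then obtain C where C: "\<And>x. x \<in> closure S \<Longrightarrow> norm (h x) \<le> C"
    by (meson compact_imp_bounded bounded_iff imageI)
  show ?thesis
    using C closure_subset by (intro square_integrable_bounded_on borel_measurable_continuous_onI h S) blast
qed

section \<open>The normal operator in Fourier coordinates\<close>

context orthonormal_system begin

lemma inner_sq_le: "(inner u (\<phi> m))\<^sup>2 \<le> (norm u)\<^sup>2"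
  using Cauchy_Schwarz_ineq[of u "\<phi> m"] by (simp add: orthonormal power2_norm_eq_inner)

text \<open>
  By Parseval the squared norm of the series is the series of the squared coefficients, which may be
  integrated term by term. This covers every series that occurs in the normal operator.
\<close>

lemma square_integrable_series:
  fixes c :: "nat \<Rightarrow> 'a::euclidean_space \<Rightarrow> real"
  assumes c [measurable]: "\<And>m. c m \<in> borel_measurable borel" and S [measurable]: "S \<in> sets borel"
    and sum: "\<And>x. x \<in> S \<Longrightarrow> summable (\<lambda>m. (c m x)\<^sup>2)"
    and int: "\<And>m. set_integrable lborel S (\<lambda>x. (c m x)\<^sup>2)"
    and le: "\<And>m. (LINT x:S|lborel. (c m x)\<^sup>2) \<le> b m" and b: "summable b"
  shows "square_integrable (\<lambda>x. indicator S x *\<^sub>R (\<Sum>m. c m x *\<^sub>R \<phi> m))"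
proof -
  let ?d = "\<lambda>m x. indicator S x * (c m x)\<^sup>2 :: real"
  have int': "integrable lborel (?d m)" for m
    using int[of m] by (simp add: set_integrable_def)
  have b0: "0 \<le> b m" for m
    by (rule order_trans[OF _ le[of m]]) (simp add: set_lebesgue_integral_def)
  have meas: "(\<lambda>x. indicator S x *\<^sub>R (\<Sum>m. c m x *\<^sub>R \<phi> m)) \<in> borel_measurable lborel"
  proof (rule borel_measurable_LIMSEQ_metric[where f="\<lambda>n x. indicator S x *\<^sub>R (\<Sum>m<n. c m x *\<^sub>R \<phi> m)"])
    show "(\<lambda>n. indicator S x *\<^sub>R (\<Sum>m<n. c m x *\<^sub>R \<phi> m)) \<longlonglongrightarrow> indicator S x *\<^sub>R (\<Sum>m. c m x *\<^sub>R \<phi> m)" for x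
    proof (cases "x \<in> S")
      case True
      then show ?thesis
        by (intro tendsto_intros summable_LIMSEQ summable_series sum)
    qed simp
  qed measurable
  have norm: "(norm (indicator S x *\<^sub>R (\<Sum>m. c m x *\<^sub>R \<phi> m)))\<^sup>2 = (\<Sum>m. ?d m x)"
    and summ: "summable (\<lambda>m. ?d m x)" for x
    by (cases "x \<in> S"; simp add: norm_series sum)+
  have "(\<integral>\<^sup>+x. ennreal (\<Sum>m. ?d m x) \<partial>lborel) = (\<integral>\<^sup>+x. (\<Sum>m. ennreal (?d m x)) \<partial>lborel)"
    by (intro nn_integral_cong suminf_ennreal2[symmetric] summ) auto
  also have "\<dots> = (\<Sum>m. \<integral>\<^sup>+x. ennreal (?d m x) \<partial>lborel)"
    by (intro nn_integral_suminf) measurable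
  also have "\<dots> \<le> (\<Sum>m. ennreal (b m))"
  proof (intro suminf_le summableI)
    fix m
    have "(\<integral>\<^sup>+x. ennreal (?d m x) \<partial>lborel) = ennreal (LINT x|lborel. ?d m x)"
      by (intro nn_integral_eq_integral int') auto
    then show "(\<integral>\<^sup>+x. ennreal (?d m x) \<partial>lborel) \<le> ennreal (b m)"
      using le[of m] by (simp add: set_lebesgue_integral_def ennreal_leI)
  qed
  also have "\<dots> = ennreal (\<Sum>m. b m)"
    by (intro suminf_ennreal2 b0 b)
  also have "\<dots> < \<infinity>" by simp
  finally have "integrable lborel (\<lambda>x. \<Sum>m. ?d m x)"
    using meas by (intro integrableI_nonneg AE_I2 suminf_nonneg summ) (auto simp flip: norm)
  then show ?thesis
    unfolding square_integrable_def norm using meas by simp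
qed

text \<open>
  The squared \<open>L\<^sup>2\<close> norm of the \<open>m\<close>-th coefficient function. By Bessel's inequality these numbers are
  summable, and they serve as the majorant for all the series below.
\<close>

definition energy :: "('a::euclidean_space, 'h) L2 \<Rightarrow> nat \<Rightarrow> real" where
  "energy f m = (LINT x|lborel. (inner (rep_L2 f x) (\<phi> m))\<^sup>2)"

lemma measurable_rep_L2 [measurable]: "rep_L2 f \<in> borel_measurable borel"
  using square_integrable_measurable[OF square_integrable_rep_L2, of f] by simp

lemma integrable_norm_rep_L2: "integrable lborel (\<lambda>x. (norm (rep_L2 f x))\<^sup>2)"
  using square_integrable_rep_L2[of f] by (simp add: square_integrable_def)

lemma integrable_mode: "integrable lborel (\<lambda>x. (inner (rep_L2 f x) (\<phi> m))\<^sup>2)"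
  by (rule Bochner_Integration.integrable_bound[OF integrable_norm_rep_L2[of f]]) (auto simp: inner_sq_le)

lemma square_integrable_mode: "square_integrable (\<lambda>x. inner (rep_L2 f x) (\<phi> m))"
  using integrable_mode[of f m] by (simp add: square_integrable_def)

lemma energy_nonneg: "0 \<le> energy f m"
  by (simp add: energy_def)

lemma summable_energy: "summable (energy f)"
proof (rule summableI_nonneg_bounded)
  show "(\<Sum>m<n. energy f m) \<le> (LINT x|lborel. (norm (rep_L2 f x))\<^sup>2)" for n
  proof -
    have "(\<Sum>m<n. energy f m) = (LINT x|lborel. (\<Sum>m<n. (inner (rep_L2 f x) (\<phi> m))\<^sup>2))"
      unfolding energy_def by (intro Bochner_Integration.integral_sum[symmetric] integrable_mode)
    also have "\<dots> \<le> (LINT x|lborel. (norm (rep_L2 f x))\<^sup>2)"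
      by (intro integral_mono integrable_norm_rep_L2 Bochner_Integration.integrable_sum integrable_mode bessel_partial)
    finally show ?thesis .
  qed
qed (rule energy_nonneg)

end

text \<open>
  The eigensystem of \<open>A\<^sup>-\<^sup>1\<close> seen abstractly: the closed span of the \<open>\<phi>\<^sub>m\<close> plays the role of \<open>L\<^sup>2(\<Omega>)\<close>, and
  boundedness of \<open>\<mu>\<close> is boundedness of \<open>A\<^sup>-\<^sup>1\<close>.
\<close>

locale heat_modes = orthonormal_system \<phi> for \<phi> :: "nat \<Rightarrow> 'h::{real_inner, banach, second_countable_topology}" +
  fixes T :: real and \<mu> :: "nat \<Rightarrow> real"
  assumes T: "T > 0" and \<mu>: "\<mu> m > 0" and Bseq: "Bseq \<mu>"
begin

definition decay :: "nat \<Rightarrow> real \<Rightarrow> real" where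
  "decay m t = exp (- (1 / \<mu> m) * (T - t))"

definition final_coeff :: "(real, 'h) L2 \<Rightarrow> nat \<Rightarrow> real" where
  "final_coeff f m = (LINT s:{0<..<T}|lborel. decay m s * inner (rep_L2 f s) (\<phi> m))"

lemma decay_measurable [measurable]: "decay m \<in> borel_measurable borel"
  unfolding decay_def by measurable

lemma decay_pos: "0 < decay m t"
  by (simp add: decay_def)

lemma decay_le_1: "t \<le> T \<Longrightarrow> decay m t \<le> 1"
  using \<mu>[of m] by (simp add: decay_def)

lemma decay_sq: "(decay m t)\<^sup>2 = exp (- (2 / \<mu> m) * (T - t))"
  by (simp add: decay_def exp_double[symmetric])

lemma decay_sq_le_1: "t \<le> T \<Longrightarrow> (decay m t)\<^sup>2 \<le> 1"
  using decay_le_1[of t m] decay_pos[of m t] by (simp add: power_le_one)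

lemma square_integrable_decay: "square_integrable (\<lambda>t. indicator {0<..<T} t *\<^sub>R decay m t)"
  by (rule square_integrable_bounded_on[where C=1]) (use decay_le_1[of _ m] decay_pos[of m] in \<open>auto simp: less_imp_le\<close>)

lemma integral_decay: "(LINT t:{0<..<T}|lborel. decay m t) = \<mu> m * (1 - decay m 0)"
  using set_integral_exp[of 0 T "1 / \<mu> m" T] T \<mu>[of m] by (simp add: decay_def)

lemma integral_decay_sq: "(LINT t:{0<..<T}|lborel. (decay m t)\<^sup>2) = \<mu> m / 2 * (1 - (decay m 0)\<^sup>2)"
  using set_integral_exp[of 0 T "2 / \<mu> m" T] T \<mu>[of m] by (simp add: decay_sq)

lemma integral_decay_sq_le: "(LINT t:{0<..<T}|lborel. (decay m t)\<^sup>2) \<le> \<mu> m / 2"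
  using \<mu>[of m] by (simp add: integral_decay_sq)

text \<open>
  The Cauchy-Schwarz inequality gains a factor \<open>\<mu>\<^sub>m\<close> here, because \<open>e\<^sub>m\<close> is concentrated within a distance
  of order \<open>\<mu>\<^sub>m\<close> of the final time. It compensates half of the factor \<open>1/\<mu>\<^sub>m\<^sup>2\<close> in
  the squared coefficients of the final term.
\<close>

lemma final_coeff_sq_le: "(final_coeff f m)\<^sup>2 \<le> \<mu> m / 2 * energy f m"
proof -
  have "(final_coeff f m)\<^sup>2 = (LINT s|lborel. (indicator {0<..<T} s *\<^sub>R decay m s) * inner (rep_L2 f s) (\<phi> m))\<^sup>2"
    by (simp add: final_coeff_def set_lebesgue_integral_def mult.assoc)
  also have "\<dots> \<le> (LINT s|lborel. (indicator {0<..<T} s *\<^sub>R decay m s)\<^sup>2) * energy f m"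
    unfolding energy_def
    by (rule Cauchy_Schwarz_integral[OF square_integrable_decay square_integrable_mode])
  also have "(LINT s|lborel. (indicator {0<..<T} s *\<^sub>R decay m s)\<^sup>2) = (LINT s:{0<..<T}|lborel. (decay m s)\<^sup>2)"
    unfolding set_lebesgue_integral_def by (intro Bochner_Integration.integral_cong) (auto simp: indicator_def)
  also have "\<dots> * energy f m \<le> \<mu> m / 2 * energy f m"
    by (intro mult_right_mono integral_decay_sq_le energy_nonneg)
  finally show ?thesis .
qed

definition final_term_coeff :: "(real, 'h) L2 \<Rightarrow> nat \<Rightarrow> real \<Rightarrow> real" where
  "final_term_coeff f m t = 1 / \<mu> m * decay m t * final_coeff f m"

lemma heat_final_term_eq: "heat_final_term T \<mu> \<phi> f t = (\<Sum>m. final_term_coeff f m t *\<^sub>R \<phi> m)"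
  by (simp add: heat_final_term_def final_term_coeff_def final_coeff_def decay_def)

lemma final_term_coeff_sq_le: "(final_term_coeff f m t)\<^sup>2 \<le> (decay m t)\<^sup>2 / (2 * \<mu> m) * energy f m"
proof -
  have "(final_term_coeff f m t)\<^sup>2 = (decay m t)\<^sup>2 / (\<mu> m)\<^sup>2 * (final_coeff f m)\<^sup>2"
    by (simp add: final_term_coeff_def power_mult_distrib power_divide)
  also have "\<dots> \<le> (decay m t)\<^sup>2 / (\<mu> m)\<^sup>2 * (\<mu> m / 2 * energy f m)"
    by (intro mult_left_mono final_coeff_sq_le) auto
  also have "\<dots> = (decay m t)\<^sup>2 / (2 * \<mu> m) * energy f m"
    using \<mu>[of m] by (simp add: field_simps power2_eq_square)
  finally show ?thesis .
qed

text \<open>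
  Convergence fails to be uniform as \<open>t\<close> approaches \<open>T\<close>: the bound \<open>x exp (-x) \<le> 1\<close> with
  \<open>x = 2(T-t)/\<mu>\<^sub>m\<close> leaves a constant \<open>1/(4(T-t))\<close>.
\<close>

lemma summable_final_term:
  assumes t: "t < T"
  shows "summable (\<lambda>m. (final_term_coeff f m t)\<^sup>2)"
proof (rule summable_comparison_test'[where N=0])
  show "summable (\<lambda>m. 1 / (4 * (T - t)) * energy f m)"
    by (intro summable_mult summable_energy)
  fix m :: nat
  define x where "x = 2 / \<mu> m * (T - t)"
  have "(decay m t)\<^sup>2 / (2 * \<mu> m) = x * exp (- x) / (4 * (T - t))"
    using t \<mu>[of m] by (simp add: decay_sq x_def field_simps)
  also have "x \<le> exp x"
    using exp_ge_add_one_self[of x] by linarith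
  then have "x * exp (- x) \<le> 1"
    using mult_right_mono[of x "exp x" "exp (- x)"] exp_minus_inverse[of x] by simp
  then have "x * exp (- x) / (4 * (T - t)) \<le> 1 / (4 * (T - t))"
    using t by (intro divide_right_mono) auto
  finally have "(decay m t)\<^sup>2 / (2 * \<mu> m) * energy f m \<le> 1 / (4 * (T - t)) * energy f m"
    by (intro mult_right_mono energy_nonneg)
  then show "norm ((final_term_coeff f m t)\<^sup>2) \<le> 1 / (4 * (T - t)) * energy f m"
    using final_term_coeff_sq_le[of f m t] by simp
qed

lemma set_integrable_decay_sq: "set_integrable lborel {0<..<T} (\<lambda>t. (decay m t)\<^sup>2)"
proof -
  have "(\<lambda>t. (norm (indicator {0<..<T} t *\<^sub>R decay m t))\<^sup>2) = (\<lambda>t. indicator {0<..<T} t *\<^sub>R (decay m t)\<^sup>2)"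
    by (auto simp: indicator_def)
  then show ?thesis
    using square_integrable_decay[of m] by (simp add: square_integrable_def set_integrable_def)
qed

text \<open>
  Although the pointwise bound on the norm blows up at \<open>T\<close>, the integral in time does not: the second half of
  the factor \<open>1/\<mu>\<^sub>m\<^sup>2\<close> is absorbed by \<open>\<integral>e\<^sub>m\<^sup>2 \<le> \<mu>\<^sub>m/2\<close>.
\<close>

lemma square_integrable_final_term:
  "square_integrable (\<lambda>t. indicator {0<..<T} t *\<^sub>R heat_final_term T \<mu> \<phi> f t)"
  unfolding heat_final_term_eq
proof (rule square_integrable_series[where b="\<lambda>m. 1/4 * energy f m"])
  have eq: "(final_term_coeff f m t)\<^sup>2 = (decay m t)\<^sup>2 * ((final_coeff f m)\<^sup>2 / (\<mu> m)\<^sup>2)" for m t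
    by (simp add: final_term_coeff_def power_mult_distrib power_divide)
  show "set_integrable lborel {0<..<T} (\<lambda>t. (final_term_coeff f m t)\<^sup>2)" for m
    unfolding eq by (intro set_integrable_mult_left set_integrable_decay_sq)
  show "(LINT t:{0<..<T}|lborel. (final_term_coeff f m t)\<^sup>2) \<le> 1/4 * energy f m" for m
  proof -
    have "(LINT t:{0<..<T}|lborel. (final_term_coeff f m t)\<^sup>2)
        = (LINT t:{0<..<T}|lborel. (decay m t)\<^sup>2) * ((final_coeff f m)\<^sup>2 / (\<mu> m)\<^sup>2)"
      unfolding eq by simp
    also have "\<dots> \<le> \<mu> m / 2 * ((\<mu> m / 2 * energy f m) / (\<mu> m)\<^sup>2)"
      using \<mu>[of m]
      by (intro mult_mono divide_right_mono integral_decay_sq_le final_coeff_sq_le) auto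
    also have "\<dots> = 1/4 * energy f m"
      using \<mu>[of m] by (simp add: power2_eq_square)
    finally show ?thesis .
  qed
  show "final_term_coeff f m \<in> borel_measurable borel" for m
    unfolding final_term_coeff_def[abs_def] by measurable
qed (auto intro!: summable_final_term summable_mult summable_energy)

lemma heat_semigroup_eq: "heat_semigroup \<mu> \<phi> (T - t) u = (\<Sum>m. (decay m t * inner u (\<phi> m)) *\<^sub>R \<phi> m)"
  by (simp add: heat_semigroup_def spectral_calculus_def decay_def)

lemma summable_heat_semigroup:
  assumes "t \<le> T" shows "summable (\<lambda>m. (decay m t * inner u (\<phi> m))\<^sup>2)"
proof (rule summable_comparison_test'[where N=0, OF bessel_summable[of u]])
  show "norm ((decay m t * inner u (\<phi> m))\<^sup>2) \<le> (inner u (\<phi> m))\<^sup>2" for m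
    using mult_right_mono[OF decay_sq_le_1[OF assms, of m], of "(inner u (\<phi> m))\<^sup>2"]
    by (simp add: power_mult_distrib)
qed

lemma square_integrable_heat_semigroup:
  assumes u [measurable]: "u \<in> borel_measurable borel"
    and int: "\<And>m. set_integrable lborel {0<..<T} (\<lambda>t. (inner (u t) (\<phi> m))\<^sup>2)"
    and le: "\<And>m. (LINT t:{0<..<T}|lborel. (inner (u t) (\<phi> m))\<^sup>2) \<le> b m" and b: "summable b"
  shows "square_integrable (\<lambda>t. indicator {0<..<T} t *\<^sub>R heat_semigroup \<mu> \<phi> (T - t) (u t))"
  unfolding heat_semigroup_eq
proof (rule square_integrable_series[OF _ _ _ _ _ b])
  have bound: "indicator {0<..<T} t * (decay m t * inner (u t) (\<phi> m))\<^sup>2 \<le> indicator {0<..<T} t * (inner (u t) (\<phi> m))\<^sup>2" for t m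
    using mult_right_mono[OF decay_sq_le_1[of t m], of "(inner (u t) (\<phi> m))\<^sup>2"]
    by (auto simp: indicator_def power_mult_distrib)
  show 1: "set_integrable lborel {0<..<T} (\<lambda>t. (decay m t * inner (u t) (\<phi> m))\<^sup>2)" for m
    using int[of m] unfolding set_integrable_def
    by (rule Bochner_Integration.integrable_bound) (use bound in auto)
  show "(LINT t:{0<..<T}|lborel. (decay m t * inner (u t) (\<phi> m))\<^sup>2) \<le> b m" for m
    using 1[of m] int[of m] bound[of _ m] unfolding set_integrable_def set_lebesgue_integral_def
    by (intro order_trans[OF _ le[of m, unfolded set_lebesgue_integral_def]] integral_mono) auto
qed (auto intro: summable_heat_semigroup)

lemma square_integrable_semigroup_const:
  "square_integrable (\<lambda>t. indicator {0<..<T} t *\<^sub>R heat_semigroup \<mu> \<phi> (T - t) g)"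
  by (rule square_integrable_heat_semigroup[where b="\<lambda>m. T * (inner g (\<phi> m))\<^sup>2"])
    (use T in \<open>auto simp: set_integrable_def set_lebesgue_integral_def intro!: summable_mult bessel_summable\<close>)

lemma square_integrable_semigroup_rep:
  "square_integrable (\<lambda>t. indicator {0<..<T} t *\<^sub>R heat_semigroup \<mu> \<phi> (T - t) (rep_L2 f t))"
proof (rule square_integrable_heat_semigroup[where b="energy f"])
  show 1: "set_integrable lborel {0<..<T} (\<lambda>t. (inner (rep_L2 f t) (\<phi> m))\<^sup>2)" for m
    unfolding set_integrable_def by (intro integrable_mult_indicator integrable_mode) auto
  show "(LINT t:{0<..<T}|lborel. (inner (rep_L2 f t) (\<phi> m))\<^sup>2) \<le> energy f m" for m
    using 1[of m] unfolding set_integrable_def set_lebesgue_integral_def energy_def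
    by (intro integral_mono integrable_mode) (auto simp: indicator_def)
qed (auto intro: summable_energy)

lemma inner_heat_semigroup: "t \<le> T \<Longrightarrow> inner (heat_semigroup \<mu> \<phi> (T - t) u) (\<phi> m) = decay m t * inner u (\<phi> m)"
  unfolding heat_semigroup_eq by (intro inner_series summable_heat_semigroup)

lemma inner_final_term: "t < T \<Longrightarrow> inner (heat_final_term T \<mu> \<phi> f t) (\<phi> m) = 1 / \<mu> m * decay m t * final_coeff f m"
  unfolding heat_final_term_eq by (simp add: inner_series summable_final_term) (simp add: final_term_coeff_def)

lemma summable_inverse: "summable (\<lambda>m. (\<mu> m * inner g (\<phi> m))\<^sup>2)"
proof -
  obtain K where K: "\<And>m. norm (\<mu> m) \<le> K" using Bseq by (auto simp: Bseq_def)
  show ?thesis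
  proof (rule summable_comparison_test'[where N=0, OF summable_mult[OF bessel_summable]])
    show "norm ((\<mu> m * inner g (\<phi> m))\<^sup>2) \<le> K\<^sup>2 * (inner g (\<phi> m))\<^sup>2" for m
      using mult_right_mono[OF power_mono[OF K[of m] norm_ge_zero, of 2], of "(inner g (\<phi> m))\<^sup>2"]
      by (simp add: power_mult_distrib)
  qed
qed

lemma spectral_calculus_inverse: "spectral_calculus \<mu> \<phi> (\<lambda>a. 1 / a) g = (\<Sum>m. (\<mu> m * inner g (\<phi> m)) *\<^sub>R \<phi> m)"
  by (simp add: spectral_calculus_def)

abbreviation "J \<equiv> {0<..<T}"

lemma square_integrable_fst:
  "square_integrable (\<lambda>t. indicator J t *\<^sub>R
    (rep_L2 f t + heat_final_term T \<mu> \<phi> f t + g + heat_semigroup \<mu> \<phi> (T - t) g))"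
proof -
  have "square_integrable (\<lambda>t. indicator J t *\<^sub>R g)"
    by (rule square_integrable_bounded_on[where C="norm g"]) auto
  then show ?thesis
    unfolding scaleR_add_right
    by (intro square_integrable_add square_integrable_restrict[OF square_integrable_rep_L2]
        square_integrable_final_term square_integrable_semigroup_const) auto
qed

lemma set_integrable_rep: "set_integrable lborel J (rep_L2 (f :: (real, 'h) L2))"
  by (intro square_integrable_imp_set_integrable square_integrable_restrict square_integrable_rep_L2) auto

lemma set_integrable_semigroup: "set_integrable lborel J (\<lambda>t. heat_semigroup \<mu> \<phi> (T - t) (rep_L2 f t))"
  by (intro square_integrable_imp_set_integrable square_integrable_semigroup_rep) auto

lemma inner_set_integral:
  assumes "set_integrable lborel J h"
  shows "inner (LINT s:J|lborel. h s) v = (LINT s:J|lborel. inner (h s) v)"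
  using assms unfolding set_integrable_def set_lebesgue_integral_def
  by (subst integral_inner_left[symmetric]) auto

text \<open>
  The operator maps the state space into itself and acts on each Fourier coefficient separately.
\<close>

lemma normal_operator_modes:
  assumes f: "f \<in> L2_on J closed_span" and g: "g \<in> closed_span" and eq: "normal_operator T \<mu> \<phi> (f, g) = (f', g')"
  shows "f' \<in> L2_on J closed_span" "g' \<in> closed_span"
    and "AE t in lborel. t \<in> J \<longrightarrow> (\<forall>m. inner (rep_L2 f' t) (\<phi> m) = inner (rep_L2 f t) (\<phi> m)
      + 1 / \<mu> m * decay m t * final_coeff f m + inner g (\<phi> m) + decay m t * inner g (\<phi> m))"
    and "inner g' (\<phi> m) = (LINT s:J|lborel. inner (rep_L2 f s) (\<phi> m)) + final_coeff f m
      + T * inner g (\<phi> m) + \<mu> m * inner g (\<phi> m)"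
proof -
  have f': "f' = class_on J (\<lambda>t. rep_L2 f t + heat_final_term T \<mu> \<phi> f t + g + heat_semigroup \<mu> \<phi> (T - t) g)"
    and g': "g' = (LINT s:J|lborel. rep_L2 f s) + (LINT s:J|lborel. heat_semigroup \<mu> \<phi> (T - s) (rep_L2 f s))
       + T *\<^sub>R g + spectral_calculus \<mu> \<phi> (\<lambda>a. 1 / a) g"
    using eq by (auto simp: normal_operator_def)
  have semi: "heat_semigroup \<mu> \<phi> (T - t) u \<in> closed_span" if "t < T" for t u
    unfolding heat_semigroup_eq using that by (intro series_in_closed_span summable_heat_semigroup) auto
  have final: "heat_final_term T \<mu> \<phi> f t \<in> closed_span" if "t < T" for t
    unfolding heat_final_term_eq using that by (intro series_in_closed_span summable_final_term) auto
  have fV: "AE t in lborel. t \<in> J \<longrightarrow> rep_L2 f t \<in> closed_span"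
    using f unfolding L2_on_def by (auto elim!: eventually_mono)
  note add = subspace_add[OF subspace_closed_span]
  show "f' \<in> L2_on J closed_span"
    unfolding f' using fV by (intro class_on_in_L2_on[OF square_integrable_fst]) (auto elim!: eventually_mono intro!: add semi final g)
  have int_V: "(LINT s:J|lborel. h s) \<in> closed_span" if "set_integrable lborel J h" "AE t in lborel. t \<in> J \<longrightarrow> h t \<in> closed_span" for h
    using that unfolding set_lebesgue_integral_def set_integrable_def
    by (intro integral_in_closed_span) (auto elim!: eventually_mono simp: indicator_def subspace_0[OF subspace_closed_span])
  show "g' \<in> closed_span"
    unfolding g' spectral_calculus_inverse
    by (intro add int_V set_integrable_rep set_integrable_semigroup fV series_in_closed_span summable_inverse subspace_scale[OF subspace_closed_span] g)
      (auto intro: semi)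
  show "AE t in lborel. t \<in> J \<longrightarrow> (\<forall>m. inner (rep_L2 f' t) (\<phi> m) = inner (rep_L2 f t) (\<phi> m)
      + 1 / \<mu> m * decay m t * final_coeff f m + inner g (\<phi> m) + decay m t * inner g (\<phi> m))"
    using rep_class_on[OF square_integrable_fst, of f g] unfolding f'[symmetric]
    by eventually_elim (auto simp: inner_add_left inner_heat_semigroup inner_final_term)
  have "(LINT s:J|lborel. inner (heat_semigroup \<mu> \<phi> (T - s) (rep_L2 f s)) (\<phi> m)) = final_coeff f m"
    unfolding final_coeff_def by (intro set_lebesgue_integral_cong) (auto simp: inner_heat_semigroup)
  then show "inner g' (\<phi> m) = (LINT s:J|lborel. inner (rep_L2 f s) (\<phi> m)) + final_coeff f m
      + T * inner g (\<phi> m) + \<mu> m * inner g (\<phi> m)"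
    unfolding g' spectral_calculus_inverse
    by (simp add: inner_add_left inner_set_integral set_integrable_rep set_integrable_semigroup inner_series summable_inverse)
qed

end

section \<open>The cubic equation\<close>

text \<open>
  This is \<open>tanh (x/2) < x/2\<close>, written without quotients; it is what keeps \<open>1\<close> from being a root of the cubic.
\<close>

lemma half_exp_gt: "0 < (x::real) \<Longrightarrow> 1 - exp (- x) < x / 2 * (1 + exp (- x))"
proof -
  assume x: "0 < x"
  define h where "h y = y / 2 * (1 + exp (- y)) - (1 - exp (- y))" for y :: real
  define h' where "h' y = 1/2 * (1 - (1 + y) * exp (- y))" for y :: real
  have "h 0 < h x"
  proof (rule DERIV_pos_imp_increasing_open[OF x])
    fix y assume y: "0 < y" "y < x"
    have "(h has_real_derivative h' y) (at y)"
      unfolding h_def h'_def by (auto intro!: derivative_eq_intros simp: field_simps)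
    moreover have "(1 + y) * exp (- y) < exp y * exp (- y)"
    proof -
      have "exp (ln (1 + y)) < exp y"
        using ln_add_one_self_less_self[of y] y by (simp del: exp_ln)
      then show ?thesis using y by simp
    qed
    then have "h' y > 0" by (simp add: h'_def exp_minus_inverse)
    ultimately show "\<exists>d. (h has_real_derivative d) (at y) \<and> d > 0" by blast
  qed (auto intro!: continuous_intros simp: h_def)
  then show ?thesis by (simp add: h_def)
qed

text \<open>
  The cubic of the claim with everything on one side, as a function of \<open>\<mu>\<^sub>m\<close> (here \<open>m\<close>) and \<open>l\<close>.
\<close>

definition charpoly :: "real \<Rightarrow> real \<Rightarrow> real \<Rightarrow> real" where
  "charpoly T m l = l^3 - l^2 * (T + 5/2 + alpha T m) + l * (3/2 * (T + 1) + beta T m) - m * exp (- (2 * T) / m)"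

text \<open>
  The determinant form of the cubic, in which the factors of the two products are the entries of the
  linear system for \<open>(g, c)\<close>. Its values at \<open>q\<close>, \<open>(3-q\<^sup>2)/2\<close> and \<open>1\<close>
  are easy to evaluate.
\<close>

lemma charpoly_det:
  fixes T m l :: real
  defines "q \<equiv> exp (- (1 / m) * T)"
  shows "charpoly T m l = (l - (3 - q\<^sup>2) / 2) * (l\<^sup>2 - l * (1 + T + m) + m * q) - (l - q) * m * ((1 - q) * (3 + q) / 2)"
proof -
  have e: "exp (- T / m) = q" "exp (- (2 * T) / m) = q\<^sup>2"
    by (simp_all add: q_def power2_eq_square flip: exp_add)
  show ?thesis
    unfolding charpoly_def alpha_def beta_def e by (simp add: field_simps power2_eq_square power3_eq_cube)
qed

lemma charpoly_one_pos:
  assumes "T > 0" "m > 0" shows "charpoly T m 1 > 0"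
proof -
  define q where "q = exp (- (1 / m) * T)"
  have q: "0 < q" "q < 1" using assms by (simp_all add: q_def)
  have "1 - q < (T / m) / 2 * (1 + q)"
    using half_exp_gt[of "T / m"] assms by (simp add: q_def)
  then have "m * (1 - q) < (1 + q) * T / 2"
    using assms by (simp add: field_simps)
  then have "0 < (1 - q) * ((1 + q) * T / 2 - m * (1 - q))"
    using q by simp
  also have "\<dots> = charpoly T m 1"
    unfolding charpoly_det q_def[symmetric] by (simp add: field_simps power2_eq_square power3_eq_cube)
  finally show ?thesis .
qed

lemma cubic_factor:
  fixes a b c :: real
  assumes "\<And>x. p x = x^3 - a * x^2 + b * x - c"
    and "p r = 0" "p s = 0" "p t = 0" "r < s" "s < t"
  shows "p x = (x - r) * (x - s) * (x - t)"
proof -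
  have "r^3 - a * r^2 + b * r - c = 0" "s^3 - a * s^2 + b * s - c = 0" "t^3 - a * t^2 + b * t - c = 0"
    using assms(2-4) unfolding assms(1) by auto
  then have "(s - r) * (s^2 + r * s + r^2 - a * (s + r) + b) = 0" "(t - r) * (t^2 + r * t + r^2 - a * (t + r) + b) = 0"
    by algebra+
  then have 1: "s^2 + r * s + r^2 - a * (s + r) + b = 0" and 2: "t^2 + r * t + r^2 - a * (t + r) + b = 0"
    using assms(5,6) by auto
  then have "(t - s) * (t + s + r - a) = 0" by algebra
  then have 3: "a = r + s + t" using assms(6) by simp
  then have 4: "b = r * s + r * t + s * t" using 1 by algebra
  then have 5: "c = r * s * t" using assms(2) 3 unfolding assms(1) by algebra
  show ?thesis unfolding assms(1) 3 4 5 by algebra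
qed

text \<open>
  The bracketing points \<open>q\<close> and \<open>A = (3-q\<^sup>2)/2\<close> each annihilate one of the two products of the
  determinant form. Thus all roots are real for every \<open>m\<close>, not merely asymptotically, and the smallest
  one is squeezed between \<open>0\<close> and \<open>q\<close>.
\<close>

lemma charpoly_roots:
  assumes T: "T > 0" and m: "m > 0"
  obtains l1 l2 l3 where "0 < l1" "l1 < exp (- T / m)" "l3 < l2"
    "\<And>x. charpoly T m x = (x - l1) * (x - l2) * (x - l3)"
proof -
  define q where "q = exp (- (1 / m) * T)"
  define A where "A = (3 - q\<^sup>2) / 2"
  \<comment> \<open>any point beyond which \<open>l\<^sup>3\<close> dominates would do\<close>
  define B where "B = A + T + m + 5"
  have q: "0 < q" "q < 1" using assms by (simp_all add: q_def)
  then have q2: "0 < q\<^sup>2" "q\<^sup>2 < 1" by (simp_all add: power_less_one_iff)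
  have A: "1 < A" using q2 by (simp add: A_def)
  note det = charpoly_det[of T m, folded q_def, folded A_def]
  have cont: "continuous_on S (charpoly T m)" for S
    unfolding charpoly_def by (intro continuous_intros)
  have p0: "charpoly T m 0 < 0"
    using m by (simp add: charpoly_def)
  have "charpoly T m q = q * (A - q) * (1 + T - q)"
    unfolding det by algebra
  moreover have "0 < q * (A - q) * (1 + T - q)" using q A T by (intro mult_pos_pos) auto
  ultimately have pq: "charpoly T m q > 0" by simp
  have "0 < (A - q) * m * ((1 - q) * (3 + q) / 2)" using q A m by (intro mult_pos_pos) auto
  then have pA: "charpoly T m A < 0" unfolding det by simp
  have pB: "charpoly T m B > 0"
  proof -
    have k: "(1 - q) * (3 + q) / 2 \<le> 3/2"
      using q zero_le_power2[of q] by (simp add: algebra_simps power2_eq_square)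
    have "(B - q) * m * ((1 - q) * (3 + q) / 2) \<le> B * m * (3/2)"
      using q A T m k by (intro mult_mono) (auto simp: B_def)
    also have "\<dots> < (T + m + 5) * (B * (A + 4))"
    proof -
      have "m * (B * (3/2)) < (T + m + 5) * (B * (A + 4))"
        using q A T m by (intro mult_strict_mono[of m] mult_strict_left_mono) (auto simp: B_def)
      then show ?thesis by (simp add: mult_ac)
    qed
    also have "\<dots> \<le> (T + m + 5) * (B\<^sup>2 - B * (1 + T + m) + m * q)"
    proof (rule mult_left_mono)
      have "0 < m * q" using m q by simp
      then show "B * (A + 4) \<le> B\<^sup>2 - B * (1 + T + m) + m * q"
        by (simp add: B_def algebra_simps power2_eq_square)
    qed (use T m in auto)
    finally show ?thesis unfolding det by (simp add: B_def add_ac)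
  qed
  have AB: "A < B" using T m by (simp add: B_def)
  obtain r where r: "0 \<le> r" "r \<le> q" "charpoly T m r = 0"
    using IVT'[of "charpoly T m" 0 0 q] p0 pq q cont by force
  obtain s where s: "q \<le> s" "s \<le> A" "charpoly T m s = 0"
    using IVT2'[of "charpoly T m" A 0 q] pA pq q A cont by force
  obtain t where t: "A \<le> t" "t \<le> B" "charpoly T m t = 0"
    using IVT'[of "charpoly T m" A 0 B] pA pB AB cont by force
  have ne: "r \<noteq> 0" "r \<noteq> q" "s \<noteq> q" "s \<noteq> A" "t \<noteq> A"
    using p0 pq pA r(3) s(3) t(3) by auto
  show thesis
  proof (rule that[of r s t])
    show "charpoly T m x = (x - r) * (x - t) * (x - s)" for x
      using cubic_factor[of "charpoly T m" "T + 5/2 + alpha T m" "3/2 * (T + 1) + beta T m" "m * exp (- (2 * T) / m)" r s t x]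
        r s t ne by (simp add: charpoly_def algebra_simps)
  qed (use r s t ne q A in \<open>auto simp: q_def\<close>)
qed

text \<open>
  Sum and product of \<open>l\<^sub>2\<close> and \<open>l\<^sub>3\<close> converge to \<open>(T+1) + 3/2\<close> and \<open>(T+1) (3/2)\<close>, and their
  order is fixed. Recovering them through their difference, the square root of the discriminant,
  also covers \<open>T = 1/2\<close>, where the two limits coincide.
\<close>

lemma charpoly_roots_tendsto:
  fixes \<mu> l1 l2 l3 :: "nat \<Rightarrow> real"
  assumes T: "T > 0" and \<mu>: "\<And>m. \<mu> m > 0" "\<mu> \<longlonglongrightarrow> 0"
    and l1: "\<And>m. 0 < l1 m" "\<And>m. l1 m < exp (- T / \<mu> m)"
    and l32: "\<And>m. l3 m < l2 m"
    and factor: "\<And>m x. charpoly T (\<mu> m) x = (x - l1 m) * (x - l2 m) * (x - l3 m)"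
  shows "l1 \<longlonglongrightarrow> 0" "l2 \<longlonglongrightarrow> max (T + 1) (3/2)" "l3 \<longlonglongrightarrow> min (T + 1) (3/2)"
    "l1 \<in> O(\<lambda>m. \<mu> m * exp (- (2 * T) / \<mu> m))"
proof -
  have filt: "filterlim (\<lambda>m. inverse (\<mu> m)) at_top sequentially"
    using \<mu> by (intro filterlim_inverse_at_top) auto
  have e0: "(\<lambda>m. exp (- c / \<mu> m)) \<longlonglongrightarrow> 0" if "c > 0" for c
  proof -
    have "filterlim (\<lambda>m. c * inverse (\<mu> m)) at_top sequentially"
      by (rule filterlim_tendsto_pos_mult_at_top[OF tendsto_const that filt])
    then have "filterlim (\<lambda>m. - (c * inverse (\<mu> m))) at_bot sequentially"
      by (simp add: filterlim_uminus_at_top)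
    then show ?thesis
      using filterlim_compose[OF exp_at_bot] by (auto simp: divide_inverse)
  qed
  have sum: "l2 m + l3 m = T + 5/2 + alpha T (\<mu> m) - l1 m"
    and prod: "l2 m * l3 m = 3/2 * (T + 1) + beta T (\<mu> m) - l1 m * (l2 m + l3 m)"
    and cnst: "l1 m * (l2 m * l3 m) = \<mu> m * exp (- (2 * T) / \<mu> m)" for m
  proof -
    let ?a = "T + 5/2 + alpha T (\<mu> m)" and ?b = "3/2 * (T + 1) + beta T (\<mu> m)"
      and ?c = "\<mu> m * exp (- (2 * T) / \<mu> m)"
    have *: "x^3 - x^2 * ?a + x * ?b - ?c = (x - l1 m) * (x - l2 m) * (x - l3 m)" for x
      using factor[of m x] by (simp add: charpoly_def)
    have c: "?c = l1 m * l2 m * l3 m" using *[of 0] by simp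
    \<comment> \<open>comparing the values at \<open>0\<close>, \<open>1\<close> and \<open>-1\<close> amounts to comparing coefficients\<close>
    have 1: "1 - ?a + ?b - ?c = (1 - l1 m) * (1 - l2 m) * (1 - l3 m)" using *[of 1] by simp
    have 2: "- 1 - ?a - ?b - ?c = (- 1 - l1 m) * (- 1 - l2 m) * (- 1 - l3 m)" using *[of "-1"] by simp
    show "l2 m + l3 m = ?a - l1 m" "l2 m * l3 m = ?b - l1 m * (l2 m + l3 m)" "l1 m * (l2 m * l3 m) = ?c"
      using 1 2 c by (simp_all add: algebra_simps)
  qed
  show l1_lim: "l1 \<longlonglongrightarrow> 0"
    by (rule tendsto_sandwich[OF _ _ tendsto_const e0[OF T]]; intro always_eventually allI less_imp_le l1)
  have alpha: "(\<lambda>m. alpha T (\<mu> m)) \<longlonglongrightarrow> 0 - 1/2 * 0"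
    unfolding alpha_def using T by (intro tendsto_intros \<mu> e0) auto
  have beta: "(\<lambda>m. beta T (\<mu> m)) \<longlonglongrightarrow> 2 * 0 * 0 - 1/2 * (T + 1) * 0"
    unfolding beta_def using T by (intro tendsto_intros \<mu> e0) auto
  have "(\<lambda>m. l2 m + l3 m) \<longlonglongrightarrow> T + 5/2 + (0 - 1/2 * 0) - 0"
    unfolding sum by (intro tendsto_intros alpha l1_lim)
  then have S: "(\<lambda>m. l2 m + l3 m) \<longlonglongrightarrow> T + 5/2" by simp
  have "(\<lambda>m. l2 m * l3 m) \<longlonglongrightarrow> 3/2 * (T + 1) + (2 * 0 * 0 - 1/2 * (T + 1) * 0) - 0 * (T + 5/2)"
    unfolding prod by (intro tendsto_intros beta l1_lim S)
  then have P: "(\<lambda>m. l2 m * l3 m) \<longlonglongrightarrow> 3/2 * (T + 1)" by simp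
  have "(\<lambda>m. sqrt ((l2 m + l3 m)\<^sup>2 - 4 * (l2 m * l3 m))) \<longlonglongrightarrow> sqrt ((T + 5/2)\<^sup>2 - 4 * (3/2 * (T + 1)))"
    by (intro tendsto_intros S P)
  also have "(\<lambda>m. sqrt ((l2 m + l3 m)\<^sup>2 - 4 * (l2 m * l3 m))) = (\<lambda>m. l2 m - l3 m)"
  proof
    fix m
    have "(l2 m + l3 m)\<^sup>2 - 4 * (l2 m * l3 m) = (l2 m - l3 m)\<^sup>2" by algebra
    then show "sqrt ((l2 m + l3 m)\<^sup>2 - 4 * (l2 m * l3 m)) = l2 m - l3 m"
      using l32[of m] by simp
  qed
  also have "(T + 5/2)\<^sup>2 - 4 * (3/2 * (T + 1)) = (T - 1/2)\<^sup>2"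
    by (simp add: field_simps power2_eq_square)
  finally have D: "(\<lambda>m. l2 m - l3 m) \<longlonglongrightarrow> \<bar>T - 1/2\<bar>" by simp
  have "(\<lambda>m. ((l2 m + l3 m) + (l2 m - l3 m)) / 2) \<longlonglongrightarrow> ((T + 5/2) + \<bar>T - 1/2\<bar>) / 2"
    by (intro tendsto_intros S D) auto
  also have "((T + 5/2) + \<bar>T - 1/2\<bar>) / 2 = max (T + 1) (3/2)"
    by (auto simp: max_def abs_if)
  finally show "l2 \<longlonglongrightarrow> max (T + 1) (3/2)" by simp
  have "(\<lambda>m. ((l2 m + l3 m) - (l2 m - l3 m)) / 2) \<longlonglongrightarrow> ((T + 5/2) - \<bar>T - 1/2\<bar>) / 2"
    by (intro tendsto_intros S D) auto
  also have "((T + 5/2) - \<bar>T - 1/2\<bar>) / 2 = min (T + 1) (3/2)"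
    by (auto simp: min_def abs_if)
  finally show "l3 \<longlonglongrightarrow> min (T + 1) (3/2)" by simp
  have "\<forall>\<^sub>F m in sequentially. l2 m * l3 m > 3/2"
    using order_tendstoD(1)[OF P, of "3/2"] T by simp
  then have "\<forall>\<^sub>F m in sequentially. norm (l1 m) \<le> 1 * norm (\<mu> m * exp (- (2 * T) / \<mu> m))"
  proof eventually_elim
    case (elim m)
    have "l1 m * 1 \<le> l1 m * (l2 m * l3 m)"
      using elim l1(1)[of m] by (intro mult_left_mono) auto
    then show ?case
      using l1(1)[of m] \<mu>(1)[of m] unfolding cnst by simp
  qed
  then show "l1 \<in> O(\<lambda>m. \<mu> m * exp (- (2 * T) / \<mu> m))" by (rule bigoI)
qed

section \<open>The eigenvalue equation of one mode\<close>

context heat_modes begin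

text \<open>
  The eigenvalue equation for \<open>(h, g) \<in> L\<^sup>2(0,T) \<times> \<real>\<close> to which the operator reduces on the \<open>m\<close>-th mode.
\<close>

definition mode_eq :: "real \<Rightarrow> nat \<Rightarrow> (real \<Rightarrow> real) \<Rightarrow> real \<Rightarrow> bool" where
  "mode_eq l m h g \<longleftrightarrow>
    (AE t in lborel. t \<in> J \<longrightarrow>
      h t + 1 / \<mu> m * decay m t * (LINT s:J|lborel. decay m s * h s) + g + decay m t * g = l * h t) \<and>
    (LINT s:J|lborel. h s) + (LINT s:J|lborel. decay m s * h s) + T * g + \<mu> m * g = l * g"

lemma mode_eq_cong:
  assumes [measurable]: "h \<in> borel_measurable borel" "h' \<in> borel_measurable borel"
    and ae: "AE t in lborel. t \<in> J \<longrightarrow> h t = h' t"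
  shows "mode_eq l m h g \<longleftrightarrow> mode_eq l m h' g"
proof -
  have 1: "(LINT s:J|lborel. h s) = (LINT s:J|lborel. h' s)"
    by (rule set_lebesgue_integral_cong_AE) (use ae in auto)
  have 2: "(LINT s:J|lborel. decay m s * h s) = (LINT s:J|lborel. decay m s * h' s)"
    by (rule set_lebesgue_integral_cong_AE) (use ae in \<open>auto elim!: eventually_mono\<close>)
  have "(AE t in lborel. t \<in> J \<longrightarrow> h t + 1 / \<mu> m * decay m t * k + g + decay m t * g = l * h t) \<longleftrightarrow>
      (AE t in lborel. t \<in> J \<longrightarrow> h' t + 1 / \<mu> m * decay m t * k + g + decay m t * g = l * h' t)" for k
    by (rule eventually_subst) (use ae in \<open>auto elim!: eventually_mono\<close>)
  then show ?thesis unfolding mode_eq_def 1 2 by simp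
qed

lemma eigen_iff:
  assumes f: "f \<in> L2_on J closed_span" and g: "g \<in> closed_span"
  shows "normal_operator T \<mu> \<phi> (f, g) = l *\<^sub>R (f, g) \<longleftrightarrow>
    (\<forall>m. mode_eq l m (\<lambda>t. inner (rep_L2 f t) (\<phi> m)) (inner g (\<phi> m)))"
proof -
  obtain f' g' where eq: "normal_operator T \<mu> \<phi> (f, g) = (f', g')" by force
  note N = normal_operator_modes[OF f g eq]
  let ?E = "\<lambda>m t. inner (rep_L2 f t) (\<phi> m) + 1 / \<mu> m * decay m t * final_coeff f m
    + inner g (\<phi> m) + decay m t * inner g (\<phi> m) = l * inner (rep_L2 f t) (\<phi> m)"
  have 1: "f' = l *\<^sub>R f \<longleftrightarrow> (AE t in lborel. t \<in> J \<longrightarrow> (\<forall>m. ?E m t))"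
  proof
    assume *: "f' = l *\<^sub>R f"
    show "AE t in lborel. t \<in> J \<longrightarrow> (\<forall>m. ?E m t)"
      using N(3) rep_L2_scaleR[of l f] unfolding * by eventually_elim auto
  next
    assume *: "AE t in lborel. t \<in> J \<longrightarrow> (\<forall>m. ?E m t)"
    show "f' = l *\<^sub>R f"
    proof (rule L2_eqI)
      show "AE t in lborel. rep_L2 f' t = rep_L2 (l *\<^sub>R f) t"
        using * N(1,3) f rep_L2_scaleR[of l f] unfolding L2_on_def mem_Collect_eq
      proof eventually_elim
        case (elim t)
        show ?case
        proof (cases "t \<in> J")
          case True
          then have "rep_L2 f' t = l *\<^sub>R rep_L2 f t"
            using elim by (intro closed_span_eqI subspace_scale[OF subspace_closed_span]) auto
          then show ?thesis using elim by simp
        qed (use elim in simp)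
      qed
    qed
  qed
  have 2: "g' = l *\<^sub>R g \<longleftrightarrow> (\<forall>m. inner g' (\<phi> m) = l * inner g (\<phi> m))"
    using closed_span_eqI[OF N(2) subspace_scale[OF subspace_closed_span g], of l] by auto
  have 3: "(AE t in lborel. t \<in> J \<longrightarrow> (\<forall>m. ?E m t)) \<longleftrightarrow> (\<forall>m. AE t in lborel. t \<in> J \<longrightarrow> ?E m t)"
    unfolding AE_all_countable[symmetric] by (simp only: all_simps)
  have "(f', g') = l *\<^sub>R (f, g) \<longleftrightarrow> f' = l *\<^sub>R f \<and> g' = l *\<^sub>R g" by simp
  then show ?thesis
    unfolding eq mode_eq_def final_coeff_def[symmetric] 1 2 3 N(4) all_conj_distrib .
qed

text \<open>
  For \<open>l = 1\<close> the first equation says that \<open>e\<^sub>m(t) c + g\<close> vanishes for almost all \<open>t\<close>, with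
  \<open>c = F/\<mu>\<^sub>m + g\<close>. Two times at which \<open>e\<^sub>m\<close> takes different values suffice to conclude.
\<close>

lemma mode_eq_one:
  "mode_eq 1 m h g \<longleftrightarrow> g = 0 \<and> (LINT s:J|lborel. h s) = 0 \<and> (LINT s:J|lborel. decay m s * h s) = 0"
proof
  define F where "F = (LINT s:J|lborel. decay m s * h s)"
  define c where "c = F / \<mu> m + g"
  assume *: "mode_eq 1 m h g"
  then have "AE t in lborel. t \<in> J \<longrightarrow> decay m t * c + g = 0"
    unfolding mode_eq_def F_def[symmetric] c_def by (auto elim!: eventually_mono simp: algebra_simps)
  then have "AE t in lborel. t \<in> {0<..<T/2} \<longrightarrow> decay m t * c + g = 0"
    "AE t in lborel. t \<in> {T/2<..<T} \<longrightarrow> decay m t * c + g = 0"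
    using T by (auto elim!: eventually_mono)
  then obtain t u where tu: "t \<in> {0<..<T/2}" "u \<in> {T/2<..<T}" "decay m t * c + g = 0" "decay m u * c + g = 0"
    using AE_interval_ex[of 0 "T/2" "\<lambda>t. decay m t * c + g = 0"]
      AE_interval_ex[of "T/2" T "\<lambda>t. decay m t * c + g = 0"] T by auto
  have "decay m t \<noteq> decay m u"
    using tu(1,2) \<mu>[of m] by (auto simp: decay_def)
  moreover have "(decay m t - decay m u) * c = 0"
    using tu(3,4) by algebra
  ultimately have "c = 0" by simp
  then have "g = 0" using tu(3) by simp
  then have "F = 0" using \<open>c = 0\<close> \<mu>[of m] by (simp add: c_def)
  then show "g = 0 \<and> (LINT s:J|lborel. h s) = 0 \<and> (LINT s:J|lborel. decay m s * h s) = 0"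
    using * \<open>g = 0\<close> by (simp add: mode_eq_def F_def)
qed (simp add: mode_eq_def)

lemma integral_affine_decay:
  "(LINT t:J|lborel. a + b * decay m t) = a * T + b * (\<mu> m * (1 - decay m 0))"
  "(LINT t:J|lborel. decay m t * (a + b * decay m t)) = a * (\<mu> m * (1 - decay m 0)) + b * (\<mu> m / 2 * (1 - (decay m 0)\<^sup>2))"
proof -
  have int: "set_integrable lborel J (decay m)"
    by (intro square_integrable_imp_set_integrable square_integrable_decay) auto
  have const: "set_integrable lborel J (\<lambda>t. a)"
    by (intro square_integrable_imp_set_integrable square_integrable_continuous) auto
  have "(LINT t:J|lborel. a) = a * T"
    using T by (simp add: set_integral_const)
  then show "(LINT t:J|lborel. a + b * decay m t) = a * T + b * (\<mu> m * (1 - decay m 0))"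
    using int const by (simp add: set_integral_add(2) integral_decay)
  have "(LINT t:J|lborel. decay m t * (a + b * decay m t)) = (LINT t:J|lborel. a * decay m t + b * (decay m t)\<^sup>2)"
    by (simp add: algebra_simps power2_eq_square)
  also have "\<dots> = a * (\<mu> m * (1 - decay m 0)) + b * (\<mu> m / 2 * (1 - (decay m 0)\<^sup>2))"
    using int set_integrable_decay_sq[of m] by (simp add: set_integral_add(2) integral_decay integral_decay_sq)
  finally show "(LINT t:J|lborel. decay m t * (a + b * decay m t)) = a * (\<mu> m * (1 - decay m 0)) + b * (\<mu> m / 2 * (1 - (decay m 0)\<^sup>2))" .
qed

lemma charpoly_decay:
  "charpoly T (\<mu> m) l = (l - (3 - (decay m 0)\<^sup>2) / 2) * (l\<^sup>2 - l * (1 + T + \<mu> m) + \<mu> m * decay m 0)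
    - (l - decay m 0) * \<mu> m * ((1 - decay m 0) * (3 + decay m 0) / 2)"
  using charpoly_det[of T "\<mu> m" l] by (simp add: decay_def)

text \<open>
  The mode equation forces \<open>h = a + b e\<^sub>m\<close>. Inserting this into the definition of \<open>F\<close> and into the
  second equation gives the two linear relations \<open>I\<close> and \<open>II\<close> between \<open>c\<close> and \<open>g\<close>, whose determinant is the
  cubic; it must vanish since \<open>(c, g) \<noteq> 0\<close>.
\<close>

lemma mode_eq_imp_root:
  assumes [measurable]: "h \<in> borel_measurable borel" and l: "l \<noteq> 1" and eq: "mode_eq l m h g"
    and nz: "g \<noteq> 0 \<or> \<not> (AE t in lborel. t \<in> J \<longrightarrow> h t = 0)"
  shows "charpoly T (\<mu> m) l = 0"
proof -
  define F where "F = (LINT s:J|lborel. decay m s * h s)"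
  define X where "X = (LINT s:J|lborel. h s)"
  define c where "c = F / \<mu> m + g"
  define q where "q = decay m 0"
  have eq2: "X + F + T * g + \<mu> m * g = l * g"
    and ae: "AE t in lborel. t \<in> J \<longrightarrow> h t + 1 / \<mu> m * decay m t * F + g + decay m t * g = l * h t"
    using eq unfolding mode_eq_def F_def[symmetric] X_def[symmetric] by auto
  define a where "a = g / (l - 1)"
  define b where "b = c / (l - 1)"
  have ab: "a * (l - 1) = g" "b * (l - 1) = c" using l by (simp_all add: a_def b_def)
  from ae have eq1: "AE t in lborel. t \<in> J \<longrightarrow> h t = a + b * decay m t"
  proof (eventually_elim, intro impI)
    fix t assume "t \<in> J \<longrightarrow> h t + 1 / \<mu> m * decay m t * F + g + decay m t * g = l * h t" "t \<in> J"
    then have "h t * (l - 1) = g + c * decay m t"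
      by (simp add: c_def algebra_simps)
    also have "\<dots> = (a + b * decay m t) * (l - 1)"
      unfolding ab[symmetric] by (simp add: algebra_simps)
    finally show "h t = a + b * decay m t" using l by simp
  qed
  have "X = (LINT t:J|lborel. a + b * decay m t)"
    unfolding X_def by (rule set_lebesgue_integral_cong_AE) (use eq1 in auto)
  then have X: "X * (l - 1) = g * T + c * (\<mu> m * (1 - q))"
    using ab unfolding integral_affine_decay q_def by algebra
  have "F = (LINT t:J|lborel. decay m t * (a + b * decay m t))"
    unfolding F_def by (rule set_lebesgue_integral_cong_AE) (use eq1 in \<open>auto elim!: eventually_mono\<close>)
  then have F: "F * (l - 1) = g * (\<mu> m * (1 - q)) + c * (\<mu> m / 2 * (1 - q\<^sup>2))"
    unfolding integral_affine_decay q_def ab[symmetric] by (simp only: distrib_left distrib_right mult_ac)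
  have Fc: "F = \<mu> m * (c - g)" using \<mu>[of m] by (simp add: c_def)
  have "\<mu> m * ((c - g) * (l - 1) - g * (1 - q) - c / 2 * (1 - q\<^sup>2)) = 0"
    using F unfolding Fc by (simp add: algebra_simps)
  then have "(c - g) * (l - 1) - g * (1 - q) - c / 2 * (1 - q\<^sup>2) = 0"
    using \<mu>[of m] by simp
  then have I: "c * (l - (3 - q\<^sup>2) / 2) = g * (l - q)"
    by (simp add: algebra_simps diff_divide_distrib)
  have "(X + F + T * g + \<mu> m * g) * (l - 1) = l * g * (l - 1)" using eq2 by simp
  then have "X * (l - 1) + F * (l - 1) + (T * g + \<mu> m * g) * (l - 1) = l * g * (l - 1)"
    by (simp add: algebra_simps)
  then have II: "c * \<mu> m * ((1 - q) * (3 + q) / 2) = g * (l\<^sup>2 - l * (1 + T + \<mu> m) + \<mu> m * q)"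
    unfolding X F by (simp add: field_simps power2_eq_square)
  have "c * charpoly T (\<mu> m) l = 0" "g * charpoly T (\<mu> m) l = 0"
    unfolding charpoly_decay q_def[symmetric] using I II by algebra+
  moreover have "c \<noteq> 0 \<or> g \<noteq> 0"
  proof (rule ccontr)
    assume "\<not> ?thesis"
    then have "a = 0" "b = 0" by (simp_all add: a_def b_def)
    then show False using nz eq1 \<open>\<not> (c \<noteq> 0 \<or> g \<noteq> 0)\<close> by simp
  qed
  ultimately show ?thesis by auto
qed

text \<open>
  Conversely, relation \<open>I\<close> of the previous proof, \<open>c (l - A) = g (l - q)\<close>, is solved by \<open>g = l - A\<close>
  and \<open>c = l - q\<close>, and then relation \<open>II\<close> is the cubic equation itself. The solution
  is nonzero since \<open>A = q\<close> would force \<open>q = 1\<close>.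
\<close>

lemma root_imp_mode_eq:
  assumes root: "charpoly T (\<mu> m) l = 0" and l: "l \<noteq> 1"
  obtains a b g where "mode_eq l m (\<lambda>t. a + b * decay m t) g" "g \<noteq> 0 \<or> (a = 0 \<and> b \<noteq> 0)"
proof -
  define q where "q = decay m 0"
  define g where "g = l - (3 - q\<^sup>2) / 2"
  define c where "c = l - q"
  have q: "0 < q" "q < 1" using T \<mu>[of m] by (simp_all add: q_def decay_def)
  define a where "a = g / (l - 1)"
  define b where "b = c / (l - 1)"
  have ab: "a * (l - 1) = g" "b * (l - 1) = c" using l by (simp_all add: a_def b_def)
  define X where "X = a * T + b * (\<mu> m * (1 - q))"
  define F where "F = a * (\<mu> m * (1 - q)) + b * (\<mu> m / 2 * (1 - q\<^sup>2))"
  have "F * (l - 1) = \<mu> m * (c - g) * (l - 1)"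
  proof -
    have "F * (l - 1) = (a * (l - 1)) * (\<mu> m * (1 - q)) + (b * (l - 1)) * (\<mu> m / 2 * (1 - q\<^sup>2))"
      by (simp add: F_def algebra_simps)
    then show ?thesis
      unfolding ab c_def g_def by (simp add: field_simps power2_eq_square power3_eq_cube)
  qed
  then have F: "F = \<mu> m * (c - g)" using l by simp
  have "X * (l - 1) + F * (l - 1) - (l - T - \<mu> m) * g * (l - 1) = - charpoly T (\<mu> m) l"
  proof -
    have "X * (l - 1) + F * (l - 1) = (a * (l - 1)) * T + (b * (l - 1)) * (\<mu> m * (1 - q))
        + (a * (l - 1)) * (\<mu> m * (1 - q)) + (b * (l - 1)) * (\<mu> m / 2 * (1 - q\<^sup>2))"
      by (simp add: X_def F_def algebra_simps)
    then show ?thesis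
      unfolding ab charpoly_decay q_def[symmetric] g_def c_def
      by (simp add: field_simps power2_eq_square power3_eq_cube)
  qed
  then have "(X + F - (l - T - \<mu> m) * g) * (l - 1) = 0" using root by (simp add: algebra_simps)
  then have "X + F - (l - T - \<mu> m) * g = 0" using l by simp
  then have eq2: "X + F + T * g + \<mu> m * g = l * g" by (simp add: algebra_simps)
  have int: "(LINT s:J|lborel. a + b * decay m s) = X" "(LINT s:J|lborel. decay m s * (a + b * decay m s)) = F"
    unfolding integral_affine_decay X_def F_def q_def by simp_all
  have eq1: "(a + b * e) + 1 / \<mu> m * e * F + g + e * g = l * (a + b * e)" for e
  proof -
    have "1 / \<mu> m * e * F = e * (c - g)" using \<mu>[of m] by (simp add: F)
    then show ?thesis using ab by algebra
  qed
  have "mode_eq l m (\<lambda>t. a + b * decay m t) g"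
    unfolding mode_eq_def int using eq1 eq2 by simp
  moreover have "g \<noteq> 0 \<or> (a = 0 \<and> b \<noteq> 0)"
  proof (cases "g = 0")
    case True
    have "l \<noteq> q"
    proof
      assume "l = q"
      then have "(q - 1) * (q + 3) = 0" using True by (simp add: g_def field_simps power2_eq_square)
      then show False using q by simp
    qed
    then show ?thesis using True l by (simp add: a_def b_def c_def)
  qed simp
  ultimately show thesis by (rule that)
qed

lemma
  fixes h :: "real \<Rightarrow> real"
  assumes h: "square_integrable (\<lambda>t. indicator J t *\<^sub>R h t)"
  shows square_integrable_single: "square_integrable (\<lambda>t. indicator J t *\<^sub>R h t *\<^sub>R \<phi> m)"
    and single_in_L2_on: "class_on J (\<lambda>t. h t *\<^sub>R \<phi> m) \<in> L2_on J closed_span"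
    and single_modes: "AE t in lborel. t \<in> J \<longrightarrow>
      inner (rep_L2 (class_on J (\<lambda>t. h t *\<^sub>R \<phi> m)) t) (\<phi> k) = (if k = m then h t else 0)"
proof -
  show 1: "square_integrable (\<lambda>t. indicator J t *\<^sub>R h t *\<^sub>R \<phi> m)"
  proof (rule square_integrable_bound)
    show "integrable lborel (\<lambda>t. (norm (indicator J t *\<^sub>R h t))\<^sup>2)"
      using h by (simp add: square_integrable_def)
    have "(\<lambda>t. (indicator J t *\<^sub>R h t) *\<^sub>R \<phi> m) \<in> borel_measurable lborel"
      by (intro borel_measurable_scaleR square_integrable_measurable[OF h]) auto
    then show "(\<lambda>t. indicator J t *\<^sub>R h t *\<^sub>R \<phi> m) \<in> borel_measurable lborel" by simp
    have "norm (\<phi> m) = 1" by (simp add: norm_eq_sqrt_inner orthonormal)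
    then show "AE t in lborel. (norm (indicator J t *\<^sub>R h t *\<^sub>R \<phi> m))\<^sup>2 \<le> (norm (indicator J t *\<^sub>R h t))\<^sup>2"
      by simp
  qed
  show "class_on J (\<lambda>t. h t *\<^sub>R \<phi> m) \<in> L2_on J closed_span"
    by (intro class_on_in_L2_on 1) (auto intro: subspace_scale[OF subspace_closed_span] basis_in_closed_span)
  show "AE t in lborel. t \<in> J \<longrightarrow>
      inner (rep_L2 (class_on J (\<lambda>t. h t *\<^sub>R \<phi> m)) t) (\<phi> k) = (if k = m then h t else 0)"
    using rep_class_on[OF 1] by eventually_elim (auto simp: orthonormal)
qed

lemma eigen_single_iff:
  assumes h: "square_integrable (\<lambda>t. indicator J t *\<^sub>R h t)" and [measurable]: "h \<in> borel_measurable borel"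
  shows "normal_operator T \<mu> \<phi> (class_on J (\<lambda>t. h t *\<^sub>R \<phi> m), g *\<^sub>R \<phi> m) = l *\<^sub>R (class_on J (\<lambda>t. h t *\<^sub>R \<phi> m), g *\<^sub>R \<phi> m)
    \<longleftrightarrow> mode_eq l m h g"
proof -
  let ?f = "class_on J (\<lambda>t. h t *\<^sub>R \<phi> m)"
  have "mode_eq l k (\<lambda>t. inner (rep_L2 ?f t) (\<phi> k)) (inner (g *\<^sub>R \<phi> m) (\<phi> k)) \<longleftrightarrow>
      mode_eq l k (\<lambda>t. if k = m then h t else 0) (if k = m then g else 0)" for k
    using single_modes[OF h, of m k] by (subst mode_eq_cong) (auto simp: orthonormal)
  moreover have "mode_eq l k (\<lambda>t. 0) 0" for k
    by (simp add: mode_eq_def)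
  ultimately show ?thesis
    by (subst eigen_iff) (auto simp: single_in_L2_on[OF h] subspace_scale[OF subspace_closed_span] basis_in_closed_span)
qed

section \<open>The spectrum\<close>

abbreviation "normal_op \<equiv> normal_operator T \<mu> \<phi>"
abbreviation "states \<equiv> L2_on J closed_span \<times> closed_span"

text \<open>
  A nonzero state has a nonzero mode, so an eigenvalue is a root of the cubic of that mode; and a
  root of the cubic of mode \<open>m\<close> has an eigenvector supported on that mode.
\<close>

lemma eigenvalues_ne_one: "{l. is_eigenvalue states normal_op l \<and> l \<noteq> 1} = {l. \<exists>m. charpoly T (\<mu> m) l = 0}"
proof (intro set_eqI iffI; clarsimp)
  fix l assume "is_eigenvalue states normal_op l" and l: "l \<noteq> 1"
  then obtain f g where f: "f \<in> L2_on J closed_span" and g: "g \<in> closed_span" and eq: "normal_op (f, g) = l *\<^sub>R (f, g)" and nz: "(f, g) \<noteq> 0"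
    unfolding is_eigenvalue_def eigenspace_def by auto
  have modes: "mode_eq l m (\<lambda>t. inner (rep_L2 f t) (\<phi> m)) (inner g (\<phi> m))" for m
    using eq eigen_iff[OF f g] by blast
  have "\<exists>m. inner g (\<phi> m) \<noteq> 0 \<or> \<not> (AE t in lborel. t \<in> J \<longrightarrow> inner (rep_L2 f t) (\<phi> m) = 0)"
  proof (rule ccontr)
    assume "\<not> ?thesis"
    then have g0: "\<And>m. inner g (\<phi> m) = 0"
      and f0: "AE t in lborel. \<forall>m. t \<in> J \<longrightarrow> inner (rep_L2 f t) (\<phi> m) = 0"
      unfolding AE_all_countable by auto
    have "f = 0"
      using f0 f rep_L2_zero unfolding L2_on_def mem_Collect_eq
      by (intro L2_eqI, eventually_elim) (use zero_if_orthogonal in auto)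
    then show False using nz zero_if_orthogonal[OF g g0] by (simp add: zero_prod_def)
  qed
  then show "\<exists>m. charpoly T (\<mu> m) l = 0"
    using mode_eq_imp_root[OF _ l modes] by auto
next
  fix l m assume root: "charpoly T (\<mu> m) l = 0"
  then show l: "is_eigenvalue states normal_op l \<and> l \<noteq> 1"
  proof -
    have l: "l \<noteq> 1" using charpoly_one_pos[OF T \<mu>[of m]] root by auto
    obtain a b g where *: "mode_eq l m (\<lambda>t. a + b * decay m t) g" "g \<noteq> 0 \<or> (a = 0 \<and> b \<noteq> 0)"
      using root_imp_mode_eq[OF root l] by blast
    let ?h = "\<lambda>t. a + b * decay m t"
    let ?z = "(class_on J (\<lambda>t. ?h t *\<^sub>R \<phi> m), g *\<^sub>R \<phi> m)"
    have h: "square_integrable (\<lambda>t. indicator J t *\<^sub>R ?h t)"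
      unfolding decay_def by (intro square_integrable_continuous continuous_intros) auto
    have "?z \<in> eigenspace states normal_op l"
      unfolding eigenspace_def mem_Collect_eq using eigen_single_iff[OF h, of m g l] *(1)
      by (auto simp: single_in_L2_on[OF h] subspace_scale[OF subspace_closed_span] basis_in_closed_span)
    moreover have "?z \<noteq> 0"
    proof
      assume "?z = 0"
      then have z: "class_on J (\<lambda>t. ?h t *\<^sub>R \<phi> m) = 0" "g *\<^sub>R \<phi> m = 0" by (auto simp: zero_prod_def)
      have "\<phi> m \<noteq> 0" using orthonormal[of m m] by auto
      then have "g = 0" using z(2) by simp
      then have ab: "a = 0" "b \<noteq> 0" using *(2) by auto
      have "AE t in lborel. t \<in> J \<longrightarrow> b * decay m t = 0"
        using single_modes[OF h, of m m] rep_L2_zero[where 'a=real and 'b='h] unfolding z(1) by eventually_elim (simp add: ab(1))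
      then show False using AE_interval_ex[of 0 T "\<lambda>t. b * decay m t = 0"] T ab by (auto simp: decay_def)
    qed
    ultimately show ?thesis using l unfolding is_eigenvalue_def by blast
  qed
qed

definition moment_free_gens :: "(real, 'h) L2 set" where
  "moment_free_gens = {class_on J (\<lambda>t. rep_L2 \<psi> t *\<^sub>R \<phi> m) | m \<psi>.
      \<psi> \<in> L2_on J UNIV
      \<and> inner \<psi> (class_on J (\<lambda>t. 1)) = 0
      \<and> inner \<psi> (class_on J (\<lambda>t. exp (- (1 / \<mu> m) * (T - t)))) = 0}"

lemma inner_class_on_one: "inner \<psi> (class_on J (\<lambda>t. 1)) = (LINT t:J|lborel. rep_L2 \<psi> t)"
proof -
  have "square_integrable (\<lambda>t. indicator J t *\<^sub>R (1::real))"
    by (rule square_integrable_continuous) auto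
  from inner_class_on[OF this, of \<psi>] show ?thesis by simp
qed

lemma inner_class_on_decay:
  "inner \<psi> (class_on J (\<lambda>t. exp (- (1 / \<mu> m) * (T - t)))) = (LINT t:J|lborel. decay m t * rep_L2 \<psi> t)"
  using inner_class_on[OF square_integrable_decay[of m], of \<psi>] by (simp add: decay_def mult.commute)

text \<open>
  The first components of the eigenvectors for the eigenvalue \<open>1\<close>.
\<close>

definition moment_free :: "(real, 'h) L2 set" where
  "moment_free = {f \<in> L2_on J closed_span. \<forall>m. (LINT t:J|lborel. inner (rep_L2 f t) (\<phi> m)) = 0 \<and> final_coeff f m = 0}"

lemma eigenspace_one: "eigenspace states normal_op 1 = moment_free \<times> {0}"
proof (intro set_eqI iffI; clarsimp simp: eigenspace_def)
  fix f g assume fg: "f \<in> L2_on J closed_span" "g \<in> closed_span" and eq: "normal_op (f, g) = (f, g)"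
  then have "\<forall>m. mode_eq 1 m (\<lambda>t. inner (rep_L2 f t) (\<phi> m)) (inner g (\<phi> m))"
    using eigen_iff[OF fg, of 1] by simp
  then show "f \<in> moment_free \<and> g = 0"
    using fg zero_if_orthogonal[OF fg(2)] by (simp add: mode_eq_one moment_free_def final_coeff_def)
next
  fix f assume "f \<in> moment_free"
  then have f: "f \<in> L2_on J closed_span" and m: "\<forall>m. mode_eq 1 m (\<lambda>t. inner (rep_L2 f t) (\<phi> m)) (inner 0 (\<phi> m))"
    by (auto simp: mode_eq_one moment_free_def final_coeff_def)
  have 0: "0 \<in> closed_span" by (rule subspace_0[OF subspace_closed_span])
  show "f \<in> L2_on J closed_span \<and> 0 \<in> closed_span \<and> normal_op (f, 0) = (f, 0)"
    using eigen_iff[OF f 0, of 1] m f 0 by simp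
qed

text \<open>
  Both moment conditions are orthogonality relations in \<open>L\<^sup>2(0,T;H)\<close>, with \<open>H\<close> the ambient Hilbert space, so they
  define a closed subspace.
\<close>

lemma moment_free_eq: "moment_free = L2_on J closed_span \<inter> (\<Inter>m. {f. inner (class_on J (\<lambda>t. \<phi> m)) f = 0} \<inter> {f. inner (class_on J (\<lambda>t. decay m t *\<^sub>R \<phi> m)) f = 0})"
proof -
  have 1: "inner (class_on J (\<lambda>t. \<phi> m)) f = (LINT t:J|lborel. inner (rep_L2 f t) (\<phi> m))" for f m
    unfolding inner_commute[of "class_on J (\<lambda>t. \<phi> m)"]
    by (rule inner_class_on, rule square_integrable_continuous) auto
  have 2: "inner (class_on J (\<lambda>t. decay m t *\<^sub>R \<phi> m)) f = final_coeff f m" for f m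
    using inner_class_on[OF square_integrable_single[OF square_integrable_decay], of f m m]
    by (simp add: final_coeff_def inner_commute)
  show ?thesis unfolding 1 2 moment_free_def by auto
qed

lemma closed_moment_free: "closed moment_free"
proof -
  have "closed_span \<noteq> {}" using basis_in_closed_span by blast
  then show ?thesis
    unfolding moment_free_eq by (intro closed_Int closed_L2_on closed_closed_span closed_INT ballI closed_hyperplane) auto
qed

lemma subspace_moment_free: "subspace moment_free"
proof -
  have "subspace {f. inner u f = 0}" for u :: "(real, 'h) L2"
    by (simp add: subspace_def inner_add_right)
  then show ?thesis
    unfolding moment_free_eq by (intro subspace_inter subspace_L2_on subspace_closed_span subspace_Inter) (auto intro!: subspace_inter)
qed

lemma moment_free_gens_subset: "moment_free_gens \<subseteq> moment_free"
proof
  fix f assume "f \<in> moment_free_gens"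
  then obtain m \<psi> where f: "f = class_on J (\<lambda>t. rep_L2 \<psi> t *\<^sub>R \<phi> m)"
    and 1: "(LINT t:J|lborel. rep_L2 \<psi> t) = 0" and 2: "(LINT t:J|lborel. decay m t * rep_L2 \<psi> t) = 0"
    unfolding moment_free_gens_def inner_class_on_one inner_class_on_decay by blast
  have sq: "square_integrable (\<lambda>t. indicator J t *\<^sub>R rep_L2 \<psi> t)"
    by (intro square_integrable_restrict square_integrable_rep_L2) auto
  have "rep_L2 \<psi> \<in> borel_measurable borel"
    using square_integrable_measurable[OF square_integrable_rep_L2, of \<psi>] by simp
  from eigen_single_iff[OF sq this, of m 0 1] have "normal_op (f, 0) = (f, 0)"
    using 1 2 by (simp add: f mode_eq_one)
  then have "(f, 0) \<in> eigenspace states normal_op 1"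
    using single_in_L2_on[OF sq] subspace_0[OF subspace_closed_span] by (simp add: eigenspace_def f)
  then show "f \<in> moment_free" by (simp add: eigenspace_one)
qed

text \<open>
  The partial sums \<open>p n\<close> of the pointwise Fourier expansion of \<open>f\<close> are sums of generators, since the
  coefficient functions of \<open>f\<close> are themselves the admissible \<open>\<psi>\<close>. They converge to \<open>f\<close> pointwise
  and are dominated by \<open>norm (f(t))\<close>, hence converge in \<open>L\<^sup>2\<close>.
\<close>

lemma moment_free_subset_closure: "moment_free \<subseteq> closure (span moment_free_gens)"
proof
  fix f assume "f \<in> moment_free"
  then have f: "f \<in> L2_on J closed_span" and f1: "\<And>m. (LINT t:J|lborel. inner (rep_L2 f t) (\<phi> m)) = 0"
    and f2: "\<And>m. (LINT t:J|lborel. decay m t * inner (rep_L2 f t) (\<phi> m)) = 0"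
    by (auto simp: moment_free_def final_coeff_def)
  \<comment> \<open>a representative for which the expansion holds at every point and not just almost everywhere\<close>
  define k where "k t = (if t \<in> J \<and> rep_L2 f t \<in> closed_span then rep_L2 f t else 0)" for t
  have V_meas: "closed_span \<in> sets borel" using closed_closed_span by simp
  have k_meas [measurable]: "k \<in> borel_measurable borel"
    unfolding k_def using V_meas by measurable
  have k_eq: "AE t in lborel. k t = rep_L2 f t"
    using f unfolding L2_on_def mem_Collect_eq by eventually_elim (auto simp: k_def)
  have kV: "k t \<in> closed_span" for t by (simp add: k_def subspace_0[OF subspace_closed_span])
  have k_sq: "square_integrable k"
    by (rule square_integrable_bound[OF _ integrable_norm_rep_L2[of f]]) (auto simp: k_def)
  have f_k: "f = abs_L2 k"
    using abs_L2_cong[OF k_sq square_integrable_rep_L2 k_eq] by (simp add: abs_rep_L2)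
  define p where "p n t = (\<Sum>m<n. inner (k t) (\<phi> m) *\<^sub>R \<phi> m)" for n t
  have p_meas: "p n \<in> borel_measurable lborel" for n
    unfolding p_def[abs_def] by measurable
  have p_lim: "(\<lambda>n. p n t) \<longlonglongrightarrow> k t" for t
    using expansion[OF kV, of t] by (simp add: p_def sums_def)
  have p_le: "norm (p n t) \<le> 2 * norm (k t)" for n t
  proof -
    have "(norm (p n t))\<^sup>2 \<le> (norm (k t))\<^sup>2"
      unfolding p_def by (simp add: norm_sum_basis bessel_partial)
    then have "norm (p n t) \<le> norm (k t)"
      by (rule power2_le_imp_le) simp
    then show ?thesis using norm_ge_zero[of "k t"] by linarith
  qed
  note lim = abs_L2_tendsto_dominated[OF k_sq p_meas p_lim p_le]
  have gen: "square_integrable (\<lambda>t. inner (k t) (\<phi> m) *\<^sub>R \<phi> m)"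
      "abs_L2 (\<lambda>t. inner (k t) (\<phi> m) *\<^sub>R \<phi> m) \<in> moment_free_gens" for m
  proof -
    have coef_sq: "square_integrable (\<lambda>t. inner (k t) (\<phi> m))"
    proof (rule square_integrable_bound)
      show "integrable lborel (\<lambda>t. (norm (k t))\<^sup>2)"
        using k_sq by (simp add: square_integrable_def)
    qed (auto simp: inner_sq_le)
    have k_J: "indicator J t *\<^sub>R k t = k t" for t by (simp add: k_def)
    have ind: "indicator J t *\<^sub>R inner (k t) (\<phi> m) = inner (k t) (\<phi> m)" for t
      using k_J[of t] by (metis inner_scaleR_left real_scaleR_def)
    then have sqJ: "square_integrable (\<lambda>t. indicator J t *\<^sub>R inner (k t) (\<phi> m))"
      using coef_sq by (simp only:)
    have ind2: "indicator J t *\<^sub>R inner (k t) (\<phi> m) *\<^sub>R \<phi> m = inner (k t) (\<phi> m) *\<^sub>R \<phi> m" for t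
      by (metis ind real_scaleR_def scaleR_scaleR)
    show sq: "square_integrable (\<lambda>t. inner (k t) (\<phi> m) *\<^sub>R \<phi> m)"
      using square_integrable_single[OF sqJ, of m] by (simp only: ind2)
    define \<psi> where "\<psi> = class_on J (\<lambda>t. inner (k t) (\<phi> m))"
    have \<psi>: "AE t in lborel. rep_L2 \<psi> t = inner (k t) (\<phi> m)"
      using rep_class_on[OF sqJ] unfolding \<psi>_def ind .
    have \<psi>_f: "AE t in lborel. rep_L2 \<psi> t = inner (rep_L2 f t) (\<phi> m)"
      using \<psi> k_eq by eventually_elim simp
    have [measurable]: "rep_L2 \<psi> \<in> borel_measurable borel"
      using square_integrable_measurable[OF square_integrable_rep_L2, of \<psi>] by simp
    have "\<psi> \<in> L2_on J UNIV"
      unfolding \<psi>_def by (rule class_on_in_L2_on[OF sqJ]) simp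
    moreover have "(LINT t:J|lborel. rep_L2 \<psi> t) = (LINT t:J|lborel. inner (rep_L2 f t) (\<phi> m))"
      by (rule set_lebesgue_integral_cong_AE) (use \<psi>_f in auto)
    moreover have "(LINT t:J|lborel. decay m t * rep_L2 \<psi> t) = (LINT t:J|lborel. decay m t * inner (rep_L2 f t) (\<phi> m))"
      by (rule set_lebesgue_integral_cong_AE) (use \<psi>_f in \<open>auto elim!: eventually_mono\<close>)
    ultimately have "class_on J (\<lambda>t. rep_L2 \<psi> t *\<^sub>R \<phi> m) \<in> moment_free_gens"
      unfolding moment_free_gens_def inner_class_on_one inner_class_on_decay using f1 f2 by auto
    moreover have "class_on J (\<lambda>t. rep_L2 \<psi> t *\<^sub>R \<phi> m) = abs_L2 (\<lambda>t. inner (k t) (\<phi> m) *\<^sub>R \<phi> m)"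
      unfolding class_on_def
    proof (rule abs_L2_cong[OF _ sq])
      show "square_integrable (\<lambda>t. indicator J t *\<^sub>R rep_L2 \<psi> t *\<^sub>R \<phi> m)"
        by (intro square_integrable_single square_integrable_restrict square_integrable_rep_L2) auto
      show "AE t in lborel. indicator J t *\<^sub>R rep_L2 \<psi> t *\<^sub>R \<phi> m = inner (k t) (\<phi> m) *\<^sub>R \<phi> m"
        using \<psi> by eventually_elim (simp only: ind2)
    qed
    ultimately show "abs_L2 (\<lambda>t. inner (k t) (\<phi> m) *\<^sub>R \<phi> m) \<in> moment_free_gens" by simp
  qed
  have "abs_L2 (p n) \<in> span moment_free_gens" for n
  proof (induction n)
    case 0
    have "abs_L2 (p 0) = 0" by (simp add: p_def[abs_def] zero_L2_def)
    then show ?case by (simp add: span_zero)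
  next
    case (Suc n)
    have "abs_L2 (p (Suc n)) = abs_L2 (p n) + abs_L2 (\<lambda>t. inner (k t) (\<phi> n) *\<^sub>R \<phi> n)"
      using abs_L2_add[OF lim(1) gen(1), of n n] by (simp add: p_def[abs_def])
    then show ?case using Suc gen(2)[of n] by (simp add: span_add span_base)
  qed
  then have "abs_L2 (p n) \<in> closure (span moment_free_gens)" for n
    using closure_subset by blast
  then show "f \<in> closure (span moment_free_gens)"
    using closure_limit[OF _ lim(2)] by (simp add: f_k)
qed

lemma moment_free_eq_closure_span: "moment_free = closure (span moment_free_gens)"
  using moment_free_subset_closure closure_minimal[OF span_minimal[OF moment_free_gens_subset subspace_moment_free] closed_moment_free] by blast

text \<open>
  This is \<open>w'' + w'/\<mu>\<^sub>m\<close> with \<open>w(t) = t\<^sup>2(T-t)\<^sup>2\<close>. Both \<open>w'' + w'/\<mu>\<^sub>m\<close> and its product with \<open>e\<^sub>m\<close> have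
  antiderivatives, \<open>w' + w/\<mu>\<^sub>m\<close> and \<open>e\<^sub>m w'\<close>, that vanish at \<open>0\<close> and \<open>T\<close>; so it is orthogonal to
  \<open>1\<close> and \<open>e\<^sub>m\<close>.
\<close>

definition witness :: "nat \<Rightarrow> real \<Rightarrow> real" where
  "witness m t = (2 * (T - t)\<^sup>2 - 8 * t * (T - t) + 2 * t\<^sup>2) + 1 / \<mu> m * (2 * t * (T - t)\<^sup>2 - 2 * t\<^sup>2 * (T - t))"

lemma continuous_witness: "continuous_on S (witness m)"
  unfolding witness_def by (intro continuous_intros)

lemma mode_eq_witness: "mode_eq 1 m (witness m) 0"
proof -
  let ?w = "\<lambda>t. t\<^sup>2 * (T - t)\<^sup>2" and ?w' = "\<lambda>t. 2 * t * (T - t)\<^sup>2 - 2 * t\<^sup>2 * (T - t)"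
  have "(LINT t:J|lborel. witness m t) = (?w' T + 1 / \<mu> m * ?w T) - (?w' 0 + 1 / \<mu> m * ?w 0)"
  proof (rule set_integral_FTC[OF less_imp_le[OF T] continuous_witness])
    show "((\<lambda>t. ?w' t + 1 / \<mu> m * ?w t) has_real_derivative witness m t) (at t)" for t
      unfolding witness_def using \<mu>[of m]
      by (auto intro!: derivative_eq_intros simp: field_simps power2_eq_square)
  qed
  moreover have "(LINT t:J|lborel. decay m t * witness m t) = decay m T * ?w' T - decay m 0 * ?w' 0"
  proof (rule set_integral_FTC[OF less_imp_le[OF T]])
    show "continuous_on UNIV (\<lambda>t. decay m t * witness m t)"
      unfolding decay_def by (intro continuous_intros continuous_witness)
    show "((\<lambda>t. decay m t * ?w' t) has_real_derivative decay m t * witness m t) (at t)" for t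
      unfolding witness_def decay_def using \<mu>[of m]
      by (auto intro!: derivative_eq_intros simp: field_simps power2_eq_square)
  qed
  ultimately show ?thesis by (simp add: mode_eq_one)
qed

lemma witness_not_AE_zero: "\<not> (AE t in lborel. t \<in> J \<longrightarrow> witness m t = 0)"
proof
  assume ae: "AE t in lborel. t \<in> J \<longrightarrow> witness m t = 0"
  have "isCont (witness m) 0"
    using continuous_witness[of UNIV] by (simp add: continuous_on_eq_continuous_at)
  moreover have "witness m 0 > 0" using T by (simp add: witness_def)
  ultimately have "\<forall>\<^sub>F t in at 0. witness m t > 0"
    using order_tendstoD(1) by (fastforce simp: isCont_def)
  then obtain d where d: "d > 0" "\<And>t. t \<noteq> 0 \<Longrightarrow> \<bar>t\<bar> < d \<Longrightarrow> witness m t > 0"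
    by (auto simp: eventually_at)
  have "AE t in lborel. t \<in> {0<..<min d T} \<longrightarrow> witness m t = 0"
    using ae by (auto elim!: eventually_mono)
  then obtain t where "t \<in> {0<..<min d T}" "witness m t = 0"
    using AE_interval_ex[of 0 "min d T" "\<lambda>t. witness m t = 0"] d(1) T by auto
  then show False using d(2)[of t] by auto
qed

text \<open>
  The witnesses of different modes give pairwise orthogonal nonzero eigenvectors.
\<close>

lemma infinite_dimensional_eigenspace_one: "infinite_dimensional (eigenspace states normal_op 1)"
  unfolding infinite_dimensional_def
proof
  define z where "z m = (class_on J (\<lambda>t. witness m t *\<^sub>R \<phi> m), 0 :: 'h)" for m
  have sq: "square_integrable (\<lambda>t. indicator J t *\<^sub>R witness m t)" for m
    by (intro square_integrable_continuous continuous_witness) auto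
  have z_eig: "z m \<in> eigenspace states normal_op 1" for m
    using eigen_single_iff[OF sq, of m m 0 1] mode_eq_witness[of m] single_in_L2_on[OF sq]
      borel_measurable_continuous_onI[OF continuous_witness] subspace_0[OF subspace_closed_span]
    by (simp add: eigenspace_def z_def)
  have nz: "z m \<noteq> 0" for m
  proof
    assume "z m = 0"
    then have "class_on J (\<lambda>t. witness m t *\<^sub>R \<phi> m) = 0" by (simp add: z_def zero_prod_def)
    then have "AE t in lborel. t \<in> J \<longrightarrow> witness m t = 0"
      using single_modes[OF sq, of m m m] rep_L2_zero[where 'a=real and 'b='h] by (auto elim: eventually_elim2)
    then show False using witness_not_AE_zero by blast
  qed
  have orth: "inner (z m) (z n) = 0" if "m \<noteq> n" for m n
  proof -
    have "inner (class_on J (\<lambda>t. witness m t *\<^sub>R \<phi> m)) (class_on J (\<lambda>t. witness n t *\<^sub>R \<phi> n)) =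
      (LINT t:J|lborel. inner (rep_L2 (class_on J (\<lambda>t. witness m t *\<^sub>R \<phi> m)) t) (witness n t *\<^sub>R \<phi> n))"
      by (rule inner_class_on[OF square_integrable_single[OF sq]])
    also have "\<dots> = (LINT t:J|lborel. 0)"
    proof (rule set_lebesgue_integral_cong_AE)
      show "AE t\<in>J in lborel. inner (rep_L2 (class_on J (\<lambda>t. witness m t *\<^sub>R \<phi> m)) t) (witness n t *\<^sub>R \<phi> n) = 0"
        using single_modes[OF sq, of m m n] that by (auto elim!: eventually_mono)
      have [measurable]: "witness n \<in> borel_measurable borel"
        using borel_measurable_continuous_onI[OF continuous_witness] .
      show "(\<lambda>t. inner (rep_L2 (class_on J (\<lambda>t. witness m t *\<^sub>R \<phi> m)) t) (witness n t *\<^sub>R \<phi> n)) \<in> borel_measurable lborel"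
        by measurable
    qed auto
    finally show ?thesis by (simp add: z_def)
  qed
  have "inj z"
    using orth nz by (metis injI inner_eq_zero_iff)
  then have "infinite (range z)" by (simp add: finite_image_iff)
  moreover have "independent (range z)"
  proof (rule pairwise_orthogonal_independent)
    show "pairwise orthogonal (range z)"
      by (auto simp: pairwise_def orthogonal_def intro!: orth)
    show "0 \<notin> range z" using nz by (metis rangeE)
  qed
  moreover assume "\<exists>B. finite B \<and> eigenspace states normal_op 1 \<subseteq> span B"
  then obtain B where "finite B" "range z \<subseteq> span B" using z_eig by blast
  ultimately show False using independent_span_bound by blast
qed

lemma is_eigenvalue_one: "is_eigenvalue states normal_op 1"
proof (rule ccontr)
  assume "\<not> is_eigenvalue states normal_op 1"
  then have "eigenspace states normal_op 1 \<subseteq> span {}" by (auto simp: is_eigenvalue_def)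
  then show False using infinite_dimensional_eigenspace_one unfolding infinite_dimensional_def by blast
qed

end

theorem mainTheorem2:
  fixes \<Omega> :: "'a::euclidean_space set" and T :: real
    and \<mu> :: "nat \<Rightarrow> real" and \<phi> :: "nat \<Rightarrow> ('a, real) L2"
  assumes "open \<Omega>" "connected \<Omega>" "bounded \<Omega>" "\<Omega> \<noteq> {}"
    and "T > 0"
    and "inverse_laplacian_eigensystem \<Omega> \<mu> \<phi>"
    and "\<And>m. \<mu> m > 0" and "\<mu> \<longlonglongrightarrow> 0"
  shows
    "(is_eigenvalue (state_space T \<Omega>) (normal_operator T \<mu> \<phi>) 1
      \<and> infinite_dimensional (eigenspace (state_space T \<Omega>) (normal_operator T \<mu> \<phi>) 1)
      \<and> eigenspace (state_space T \<Omega>) (normal_operator T \<mu> \<phi>) 1 =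
          {(f, 0) | f. f \<in> closure (span {class_on {0<..<T} (\<lambda>t. rep_L2 \<psi> t *\<^sub>R \<phi> m) | m \<psi>.
            \<psi> \<in> L2_on {0<..<T} UNIV
            \<and> inner \<psi> (class_on {0<..<T} (\<lambda>t. 1)) = 0
            \<and> inner \<psi> (class_on {0<..<T} (\<lambda>t. exp (- (1 / \<mu> m) * (T - t)))) = 0})})
     \<and> {l. is_eigenvalue (state_space T \<Omega>) (normal_operator T \<mu> \<phi>) l \<and> l \<noteq> 1} =
          {l. \<exists>m. l^3 - l^2 * (T + 5/2 + alpha T (\<mu> m)) + l * (3/2 * (T + 1) + beta T (\<mu> m))
                  = \<mu> m * exp (- (2 * T) / \<mu> m)}
     \<and> (\<exists>l1 l2 l3 :: nat \<Rightarrow> real.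
          (\<forall>m x. x^3 - x^2 * (T + 5/2 + alpha T (\<mu> m)) + x * (3/2 * (T + 1) + beta T (\<mu> m))
                  - \<mu> m * exp (- (2 * T) / \<mu> m) = (x - l1 m) * (x - l2 m) * (x - l3 m))
          \<and> l1 \<longlonglongrightarrow> 0
          \<and> l2 \<longlonglongrightarrow> max (T + 1) (3/2)
          \<and> l3 \<longlonglongrightarrow> min (T + 1) (3/2)
          \<and> (\<exists>m0. \<forall>m\<ge>m0. l1 m > 0)
          \<and> l1 \<in> O(\<lambda>m. \<mu> m * exp (- (2 * T) / \<mu> m)))"
proof -
  note pos = assms(5) and eig = assms(7) and lim0 = assms(8)
  have basis: "inner (\<phi> m) (\<phi> n) = (if m = n then 1 else 0)" "closure (span (range \<phi>)) = L2_on \<Omega> UNIV" for m n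
    using assms(6) by (auto simp: inverse_laplacian_eigensystem_def orthonormal_basis_def)
  interpret heat_modes \<phi> T \<mu>
    by unfold_locales (use pos eig lim0 basis convergent_imp_Bseq[of \<mu>] in \<open>auto simp: convergent_def\<close>)
  have space_eq: "state_space T \<Omega> = L2_on {0<..<T} closed_span \<times> closed_span"
    by (simp add: state_space_def closed_span_def basis(2))
  have cubic: "charpoly T m l = 0 \<longleftrightarrow>
      l^3 - l^2 * (T + 5/2 + alpha T m) + l * (3/2 * (T + 1) + beta T m) = m * exp (- (2 * T) / m)" for m l
    unfolding charpoly_def by simp
  have space: "eigenspace (state_space T \<Omega>) (normal_operator T \<mu> \<phi>) 1 = {(f, 0) | f. f \<in> closure (span moment_free_gens)}"
    unfolding space_eq eigenspace_one moment_free_eq_closure_span by auto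
  have "\<forall>m. \<exists>l1 l2 l3. 0 < l1 \<and> l1 < exp (- T / \<mu> m) \<and> l3 < l2 \<and>
      (\<forall>x. charpoly T (\<mu> m) x = (x - l1) * (x - l2) * (x - l3))"
    using charpoly_roots[OF pos eig] by metis
  then obtain l1 l2 l3 where l: "\<And>m. 0 < l1 m" "\<And>m. l1 m < exp (- T / \<mu> m)" "\<And>m. l3 m < l2 m" and factor: "\<And>m x. charpoly T (\<mu> m) x = (x - l1 m) * (x - l2 m) * (x - l3 m)"
    by metis
  note lim = charpoly_roots_tendsto[OF pos eig lim0 l factor]
  show ?thesis
  proof (intro conjI)
    show "is_eigenvalue (state_space T \<Omega>) (normal_operator T \<mu> \<phi>) 1"
      unfolding space_eq by (rule is_eigenvalue_one)
    show "infinite_dimensional (eigenspace (state_space T \<Omega>) (normal_operator T \<mu> \<phi>) 1)"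
      unfolding space_eq by (rule infinite_dimensional_eigenspace_one)
    show "{l. is_eigenvalue (state_space T \<Omega>) (normal_operator T \<mu> \<phi>) l \<and> l \<noteq> 1} =
          {l. \<exists>m. l^3 - l^2 * (T + 5/2 + alpha T (\<mu> m)) + l * (3/2 * (T + 1) + beta T (\<mu> m))
                  = \<mu> m * exp (- (2 * T) / \<mu> m)}"
      unfolding space_eq cubic[symmetric] by (rule eigenvalues_ne_one)
  qed (rule space[unfolded moment_free_gens_def],
      rule exI[of _ l1], rule exI[of _ l2], rule exI[of _ l3],
      intro conjI allI lim factor[unfolded charpoly_def] exI[of _ 0] impI l(1))
qed

end
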